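(* Let $D\subset\mathbb{C}^{n}$ be a pseudoconvex Reinhardt domain. Fix $z_{0}\in D$ and $\zeta_{0}\in\partial D\cap\operatorname{int}\overline{D}$, where $\operatorname{int}\overline{D}$ is the interior of the closure of $D$. Then there exist a constant $C\in\mathbb{R}$ and an open neighbourhood $U\subset\mathbb{C}^n$ of $\zeta_0$ such that $d_D(z)<1$ and $$k_{D}(z_{0},z)\leq\frac{1}{2}\log\bigl(-\log d_D(z)\bigr)+C\qquad\text{for all } z\in D\cap U.$$
   Context: A domain is a non-empty connected open set. A domain $D\subset\mathbb{C}^n$ is a Reinhardt domain if $(\lambda_{1}z_{1},\ldots,\lambda_{n}z_{n})\in D$ for all $z\in D$ and all $\lambda_1,\ldots,\lambda_n\in\mathbb{C}$ with $|\lambda_j|=1$. For $z\in D$, $d_D(z)$ denotes the Euclidean distance from $z$ to $\partial D$ (so $d_D(z)<1$, and $-\log d_D(z)>0$, for $z$ close to $\zeta_0$). Let $\mathbb{D}\subset\mathbb{C}$ be the unit disc and $p$ the Poincaré distance on $\mathbb{D}$, normalized by $p(\lambda,\mu)=\tanh^{-1}\left|\frac{\lambda-\mu}{1-\overline{\mu}\lambda}\right|$, so that $p(0,\lambda)=\frac12\log\frac{1+|\lambda|}{1-|\lambda|}$. The Lempert function of $D$ is $$\widetilde{k}_{D}(w,z):=\inf\{p(\lambda,\mu):\lambda,\mu\in\mathbb{D}\text{ and there is a holomorphic } f:\mathbb{D}\to D \text{ with } f(\lambda)=w,\ f(\mu)=z\}.$$ The Kobayashi (pseudo)distance $k_D$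 is the largest pseudodistance on $D$ that is less than or equal to $\widetilde{k}_D$; equivalently, $k_D(w,z)$ is the infimum of $\sum_{j=1}^{N}\widetilde{k}_D(w_{j-1},w_j)$ over all $N\geq 1$ and all finite chains $w=w_0,w_1,\ldots,w_N=z$ in $D$. *)

theory Defs
  imports "HOL-Analysis.Analysis"
begin

definition is_domain :: "(complex ^ 'n) set \<Rightarrow> bool" where
  "is_domain D \<longleftrightarrow> D \<noteq> {} \<and> open D \<and> connected D"

definition reinhardt :: "(complex ^ 'n) set \<Rightarrow> bool" where
  "reinhardt D \<longleftrightarrow>
     (\<forall>z\<in>D. \<forall>l :: complex ^ 'n. (\<forall>j. cmod (l $ j) = 1) \<longrightarrow> (\<chi> j. l $ j * z $ j) \<in> D)"

(* Junk value: for D = UNIV the frontier is empty and infdist returns 0 (instead of infinity). *)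
definition bdry_dist :: "(complex ^ 'n) set \<Rightarrow> complex ^ 'n \<Rightarrow> real" where
  "bdry_dist D z = infdist z (frontier D)"

(* Plurisubharmonicity of a real-valued (nowhere -infinity) function: upper semicontinuity and the
   sub-mean value inequality on every closed disc of every complex line.
   Integrability is part of the inequality: an upper semicontinuous function is bounded above on
   the circle, so if it is not integrable then its mean is -infinity, which is less than u a. *)
definition plurisubharmonic_on ::
    "(complex ^ 'n) set \<Rightarrow> (complex ^ 'n \<Rightarrow> real) \<Rightarrow> bool" where
  "plurisubharmonic_on D u \<longleftrightarrow>
     (\<forall>x\<in>D. \<forall>c > u x. \<forall>\<^sub>F y in at x within D. u y < c) \<and>
     (\<forall>a b. (\<forall>\<xi>\<in>cball 0 1. a + \<xi> *s b \<in> D) \<longrightarrow>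
        (\<lambda>t. u (a + cis t *s b)) absolutely_integrable_on {0..2 * pi} \<and>
        u a \<le> 1 / (2 * pi) * integral {0..2 * pi} (\<lambda>t. u (a + cis t *s b)))"

(* The case D = UNIV is separate because the boundary distance is infinite there. *)
definition pseudoconvex :: "(complex ^ 'n) set \<Rightarrow> bool" where
  "pseudoconvex D \<longleftrightarrow> D = UNIV \<or> plurisubharmonic_on D (\<lambda>z. - ln (bdry_dist D z))"

definition poincare_dist :: "complex \<Rightarrow> complex \<Rightarrow> real" where
  "poincare_dist l m = artanh (cmod ((l - m) / (1 - cnj m * l)))"

definition holomorphic_disc :: "(complex ^ 'n) set \<Rightarrow> (complex \<Rightarrow> complex ^ 'n) \<Rightarrow> bool" where
  "holomorphic_disc D f \<longleftrightarrow>
     (\<forall>j. (\<lambda>x. f x $ j) holomorphic_on ball 0 1) \<and> f ` ball 0 1 \<subseteq> D"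

(* Infima are taken in ereal, so that an infimum over the empty set is infinity. *)
definition lempert :: "(complex ^ 'n) set \<Rightarrow> complex ^ 'n \<Rightarrow> complex ^ 'n \<Rightarrow> ereal" where
  "lempert D w z =
     Inf {ereal (poincare_dist l m) | l m. l \<in> ball 0 1 \<and> m \<in> ball 0 1 \<and>
            (\<exists>f. holomorphic_disc D f \<and> f l = w \<and> f m = z)}"

definition kobayashi :: "(complex ^ 'n) set \<Rightarrow> complex ^ 'n \<Rightarrow> complex ^ 'n \<Rightarrow> ereal" where
  "kobayashi D w z =
     Inf {(\<Sum>j=1..N. lempert D (c (j - 1)) (c j)) | (N :: nat) c.
            1 \<le> N \<and> c 0 = w \<and> c N = z \<and> (\<forall>j\<le>N. c j \<in> D)}"

(* The following lemmas confirm that kobayashi is the largest pseudodistance below lempert. *)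

lemma poincare_dist_commute: "poincare_dist l m = poincare_dist m l"
proof -
  have "cmod (1 - cnj m * l) = cmod (cnj (1 - cnj m * l))" by (rule complex_mod_cnj[symmetric])
  also have "\<dots> = cmod (1 - cnj l * m)" by (simp add: mult.commute)
  finally show ?thesis by (simp add: poincare_dist_def norm_divide norm_minus_commute)
qed

lemma poincare_dist_nonneg:
  assumes "cmod l < 1" "cmod m < 1"
  shows "0 \<le> poincare_dist l m"
proof -
  have "(cmod (1 - cnj m * l))\<^sup>2 - (cmod (l - m))\<^sup>2 = (1 - (cmod l)\<^sup>2) * (1 - (cmod m)\<^sup>2)"
    unfolding cmod_power2 by (simp add: algebra_simps power2_eq_square)
  moreover have "0 < (1 - (cmod l)\<^sup>2) * (1 - (cmod m)\<^sup>2)"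
    using assms by (simp add: abs_square_less_1)
  ultimately have "(cmod (l - m))\<^sup>2 < (cmod (1 - cnj m * l))\<^sup>2" by simp
  hence less: "cmod (l - m) < cmod (1 - cnj m * l)" by (rule power_less_imp_less_base) simp
  hence "0 < cmod (1 - cnj m * l)" using norm_ge_zero[of "l - m"] by linarith
  define x where "x = cmod ((l - m) / (1 - cnj m * l))"
  have x: "0 \<le> x" "x < 1"
    using less \<open>0 < cmod (1 - cnj m * l)\<close> unfolding x_def norm_divide
    by (simp_all add: divide_less_eq)
  hence "1 \<le> (1 + x) / (1 - x)" by (simp add: field_simps)
  thus ?thesis by (simp add: poincare_dist_def x_def[symmetric] artanh_def)
qed

lemma lempert_nonneg: "0 \<le> lempert D w z"
  unfolding lempert_def by (rule Inf_greatest) (auto intro: poincare_dist_nonneg)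

lemma lempert_commute: "lempert D w z = lempert D z w"
  unfolding lempert_def
  by (rule arg_cong[of _ _ Inf]) (use poincare_dist_commute in blast)

lemma lempert_refl:
  assumes "z \<in> D" shows "lempert D z z = 0"
proof (rule antisym[OF _ lempert_nonneg])
  have "holomorphic_disc D (\<lambda>_. z)" using assms by (auto simp: holomorphic_disc_def)
  hence "lempert D z z \<le> ereal (poincare_dist 0 0)"
    unfolding lempert_def by (intro Inf_lower) force
  thus "lempert D z z \<le> 0" by (simp add: poincare_dist_def zero_ereal_def)
qed

lemma kobayashi_nonneg: "0 \<le> kobayashi D w z"
  unfolding kobayashi_def
  by (rule Inf_greatest, clarify, rule sum_nonneg, rule lempert_nonneg)

lemma kobayashi_le_lempert:
  assumes "w \<in> D" "z \<in> D" shows "kobayashi D w z \<le> lempert D w z"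
  unfolding kobayashi_def
  by (rule Inf_lower, rule CollectI, rule exI[of _ "1::nat"], rule exI[of _ "\<lambda>j::nat. if j = 0 then w else z"])
     (use assms in auto)

lemma kobayashi_refl:
  assumes "z \<in> D" shows "kobayashi D z z = 0"
  using kobayashi_le_lempert[OF assms assms] kobayashi_nonneg[of D z z] lempert_refl[OF assms]
  by simp

lemma kobayashi_commute_le: "kobayashi D z w \<le> kobayashi D w z"
  unfolding kobayashi_def[of D w z]
proof (rule Inf_greatest, clarify)
  fix N :: nat and c :: "nat \<Rightarrow> complex ^ 'a"
  assume N: "1 \<le> N" and D: "\<forall>j\<le>N. c j \<in> D"
  have "(\<Sum>j=1..N. lempert D (c (j - 1)) (c j)) =
        (\<Sum>j=1..N. lempert D (c (N - (j - 1))) (c (N - j)))"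
    by (rule sum.reindex_bij_witness[of _ "\<lambda>j. N + 1 - j" "\<lambda>j. N + 1 - j"])
       (auto simp: lempert_commute)
  moreover have "kobayashi D (c N) (c 0) \<le>
        (\<Sum>j=1..N. lempert D (c (N - (j - 1))) (c (N - j)))"
    unfolding kobayashi_def
    by (rule Inf_lower, rule CollectI, rule exI[of _ N], rule exI[of _ "\<lambda>j. c (N - j)"])
       (use N D in auto)
  ultimately show "kobayashi D (c N) (c 0) \<le> (\<Sum>j=1..N. lempert D (c (j - 1)) (c j))"
    by simp
qed

lemma kobayashi_commute: "kobayashi D w z = kobayashi D z w"
  by (intro antisym kobayashi_commute_le)

lemma kobayashi_triangle: "kobayashi D x z \<le> kobayashi D x y + kobayashi D y z"
proof -
  have chain: "kobayashi D (c 0) (e M) \<le>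
      (\<Sum>j=1..N. lempert D (c (j - 1)) (c j)) + (\<Sum>j=1..M. lempert D (e (j - 1)) (e j))"
    if "1 \<le> N" "1 \<le> M" "c N = e 0" "\<forall>j\<le>N. c j \<in> D" "\<forall>j\<le>M. e j \<in> D"
    for N M and c e :: "nat \<Rightarrow> complex ^ 'a"
  proof -
    define g where "g j = (if j \<le> N then c j else e (j - N))" for j
    have "(\<Sum>j=1..N + M. lempert D (g (j - 1)) (g j)) =
        (\<Sum>j=1..N. lempert D (g (j - 1)) (g j)) + (\<Sum>j=N+1..N+M. lempert D (g (j - 1)) (g j))"
      using sum.ub_add_nat[of 1 N _ M] that by simp
    also have "(\<Sum>j=1..N. lempert D (g (j - 1)) (g j)) = (\<Sum>j=1..N. lempert D (c (j - 1)) (c j))"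
      by (rule sum.cong) (auto simp: g_def)
    also have "(\<Sum>j=N+1..N+M. lempert D (g (j - 1)) (g j)) =
        (\<Sum>j=1..M. lempert D (e (j - 1)) (e j))"
    proof (rule sum.reindex_bij_witness[of _ "\<lambda>j. j + N" "\<lambda>j. j - N"])
      fix j assume "j \<in> {N+1..N+M}"
      then consider "j = N + 1" | "N + 1 < j" by force
      thus "lempert D (e (j - N - 1)) (e (j - N)) = lempert D (g (j - 1)) (g j)"
        by cases (auto simp: g_def that(3))
    qed auto
    finally have eq: "(\<Sum>j=1..N + M. lempert D (g (j - 1)) (g j)) =
      (\<Sum>j=1..N. lempert D (c (j - 1)) (c j)) + (\<Sum>j=1..M. lempert D (e (j - 1)) (e j))" .
    show ?thesis unfolding eq[symmetric] kobayashi_def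
      by (rule Inf_lower, rule CollectI, rule exI[of _ "N + M"], rule exI[of _ g])
         (use that in \<open>auto simp: g_def\<close>)
  qed
  let ?S = "\<lambda>w z. {(\<Sum>j=1..N. lempert D (c (j - 1)) (c j)) | (N :: nat) c.
            1 \<le> N \<and> c 0 = w \<and> c N = z \<and> (\<forall>j\<le>N. c j \<in> D)}"
  have pair: "kobayashi D x z \<le> s + t" if st: "s \<in> ?S x y" "t \<in> ?S y z" for s t
  proof -
    obtain N :: nat and c where "s = (\<Sum>j=1..N. lempert D (c (j - 1)) (c j))"
      "1 \<le> N" "c 0 = x" "c N = y" "\<forall>j\<le>N. c j \<in> D"
      using st(1) by blast
    moreover obtain M :: nat and e where "t = (\<Sum>j=1..M. lempert D (e (j - 1)) (e j))"
      "1 \<le> M" "e 0 = y" "e M = z" "\<forall>j\<le>M. e j \<in> D"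
      using st(2) by blast
    ultimately show ?thesis using chain[of N M c e] by simp
  qed
  show ?thesis
  proof (cases "kobayashi D x y = \<infinity> \<or> kobayashi D y z = \<infinity>")
    case True
    thus ?thesis using kobayashi_nonneg[of D x y] kobayashi_nonneg[of D y z] by auto
  next
    case False
    then obtain a b where a: "kobayashi D x y = ereal a" and b: "kobayashi D y z = ereal b"
      using kobayashi_nonneg[of D x y] kobayashi_nonneg[of D y z]
      by (cases "kobayashi D x y"; cases "kobayashi D y z") auto
    show ?thesis
    proof (rule ereal_le_epsilon2)
      fix \<epsilon> :: real assume e: "0 < \<epsilon>"
      have "kobayashi D x y < ereal (a + \<epsilon> / 2)" "kobayashi D y z < ereal (b + \<epsilon> / 2)"
        using e by (simp_all add: a b)
      hence "Inf (?S x y) < ereal (a + \<epsilon> / 2)" "Inf (?S y z) < ereal (b + \<epsilon> / 2)"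
        unfolding kobayashi_def .
      then obtain s t where s: "s \<in> ?S x y" "s < ereal (a + \<epsilon> / 2)"
        and t: "t \<in> ?S y z" "t < ereal (b + \<epsilon> / 2)"
        unfolding Inf_less_iff by blast
      have "kobayashi D x z \<le> s + t" by (rule pair[OF s(1) t(1)])
      also have "\<dots> \<le> ereal (a + \<epsilon> / 2) + ereal (b + \<epsilon> / 2)"
        using s(2) t(2) by (intro add_mono) auto
      finally show "kobayashi D x z \<le> kobayashi D x y + kobayashi D y z + ereal \<epsilon>"
        by (simp add: a b add_ac)
    qed
  qed
qed

lemma kobayashi_greatest:
  fixes d :: "complex ^ 'n \<Rightarrow> complex ^ 'n \<Rightarrow> real"
  assumes triangle: "\<And>x y z. x \<in> D \<Longrightarrow> y \<in> D \<Longrightarrow> z \<in> D \<Longrightarrow> d x z \<le> d x y + d y z"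
    and refl: "\<And>x. x \<in> D \<Longrightarrow> d x x = 0"
    and below: "\<And>x y. x \<in> D \<Longrightarrow> y \<in> D \<Longrightarrow> ereal (d x y) \<le> lempert D x y"
  shows "ereal (d w z) \<le> kobayashi D w z"
  unfolding kobayashi_def
proof (rule Inf_greatest, clarify)
  fix N :: nat and c :: "nat \<Rightarrow> complex ^ 'n"
  assume "\<forall>j\<le>N. c j \<in> D"
  thus "ereal (d (c 0) (c N)) \<le> (\<Sum>j=1..N. lempert D (c (j - 1)) (c j))"
  proof (induction N)
    case 0
    thus ?case by (simp add: refl)
  next
    case (Suc N)
    have "ereal (d (c 0) (c (Suc N))) \<le> ereal (d (c 0) (c N)) + ereal (d (c N) (c (Suc N)))"
      using triangle[of "c 0" "c N" "c (Suc N)"] Suc.prems by simp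
    also have "\<dots> \<le> (\<Sum>j=1..N. lempert D (c (j - 1)) (c j)) + lempert D (c N) (c (Suc N))"
      using Suc by (intro add_mono below) auto
    finally show ?case by simp
  qed
qed

end

theory Submission
  imports Defs "HOL-Complex_Analysis.Cauchy_Integral_Formula"
begin

text \<open>
  Let \<open>u = - log d\<^sub>D\<close>. The sub-mean value property of \<open>u\<close> on complex lines and the torus invariance
  of \<open>D\<close> have two consequences. First, if \<open>D\<close> meets \<open>{z\<^sub>j = 0}\<close>, then \<open>D\<close> is complete in the
  coordinate \<open>z\<^sub>j\<close>. Second, the logarithmic image of \<open>D\<close> is convex, so it equals the interior of its
  closure. Hence near \<open>\<zeta>\<^sub>0\<close> the domain is the complement of the hyperplanes \<open>{z\<^sub>j = 0}\<close>, \<open>j \<in> J\<close>, that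
  contain \<open>\<zeta>\<^sub>0\<close> and do not meet \<open>D\<close>; in particular \<open>d\<^sub>D(z) \<le> |z\<^sub>j|\<close> for \<open>j \<in> J\<close>. There \<open>z\<close> is joined to
  a point of a fixed compact subset of \<open>D\<close> by a single disc whose coordinates in \<open>J\<close> are exponentials of
  affine functions on a half-plane. Its Poincare length is \<open>(log R)/2\<close> with
  \<open>R = max\<^sub>j log (r / |z\<^sub>j|) \<le> - log d\<^sub>D(z)\<close>.
\<close>

section \<open>Kobayashi distance on compact sets\<close>

lemma lempert_le:
  assumes "holomorphic_disc D f" "l \<in> ball 0 1" "m \<in> ball 0 1"
  shows "lempert D (f l) (f m) \<le> ereal (poincare_dist l m)"
  unfolding lempert_def by (rule Inf_lower) (use assms in blast)

text \<open>The affine disc \<open>f\<close> stays in the ball and passes through \<open>x\<close>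
  at 0 and through \<open>y\<close> at 1/2. The bound is independent of the radius
  \<open>e\<close>.\<close>

lemma lempert_ball:
  fixes x y :: "complex ^ 'n"
  assumes "ball x e \<subseteq> D" "y \<in> ball x (e / 2)"
  shows "lempert D x y \<le> ereal (artanh (1 / 2))"
proof -
  define f where "f l = x + (2 * l) *s (y - x)" for l :: complex
  have "f l \<in> ball x e" if "l \<in> ball 0 1" for l
  proof -
    have "norm ((2 * l) *s (y - x)) = cmod (2 * l) * norm (y - x)"
      unfolding norm_vec_def
      by (simp only: vector_smult_component norm_mult L2_set_right_distrib norm_ge_zero
          mult_nonneg_nonneg)
    also have "\<dots> \<le> 2 * norm (y - x)"
      using that by (intro mult_right_mono) (auto simp: norm_mult)
    also have "\<dots> < e" using assms(2) by (simp add: dist_norm norm_minus_commute)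
    finally show ?thesis unfolding f_def mem_ball dist_norm by (metis norm_minus_cancel add_diff_cancel_left' minus_diff_eq)
  qed
  moreover have "(\<lambda>l. f l $ j) holomorphic_on ball 0 1" for j
    unfolding f_def by (auto intro!: holomorphic_intros)
  ultimately have "holomorphic_disc D f"
    using assms(1) by (auto simp: holomorphic_disc_def)
  moreover have "f 0 = x" "f (1 / 2) = y" by (simp_all add: f_def vec_eq_iff)
  ultimately have "lempert D x y \<le> ereal (poincare_dist 0 (1 / 2))"
    using lempert_le[of D f 0 "1 / 2"] by simp
  thus ?thesis by (simp add: poincare_dist_def norm_divide)
qed

lemma kobayashi_ball:
  fixes x y :: "complex ^ 'n"
  assumes "ball x e \<subseteq> D" "y \<in> ball x (e / 2)"
  shows "kobayashi D x y \<le> ereal (artanh (1 / 2))"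
proof -
  have "0 < e" using assms(2) by (metis mem_ball zero_le_dist le_less_trans half_gt_zero_iff)
  moreover have "dist x y < e" using assms(2) \<open>0 < e\<close> by simp
  ultimately have "x \<in> D" "y \<in> D" using assms by auto
  thus ?thesis using kobayashi_le_lempert lempert_ball[OF assms] order_trans by blast
qed

text \<open>Finiteness of the distance from \<open>w\<close> is locally constant by
  \<open>kobayashi_ball\<close> and the triangle inequality, so connectedness spreads it from
  \<open>w\<close> to all of \<open>D\<close>.\<close>

lemma kobayashi_finite:
  fixes w z :: "complex ^ 'n"
  assumes D: "is_domain D" and w: "w \<in> D" and z: "z \<in> D"
  shows "kobayashi D w z < \<infinity>"
proof -
  have op: "open D" and con: "connected D" using D by (auto simp: is_domain_def)
  define S where "S = {x \<in> D. kobayashi D w x < \<infinity>}"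
  have near: "\<exists>e>0. ball x e \<subseteq> D \<and> (\<forall>y\<in>ball x e. y \<in> S \<longleftrightarrow> x \<in> S)" if x: "x \<in> D" for x
  proof -
    obtain e where e: "e > 0" "ball x e \<subseteq> D" using op x by (meson open_contains_ball)
    have "y \<in> S \<longleftrightarrow> x \<in> S" if y: "y \<in> ball x (e / 2)" for y
    proof -
      have k: "kobayashi D x y < \<infinity>" "kobayashi D y x < \<infinity>"
        using kobayashi_ball[OF e(2) y] kobayashi_commute[of D x y] by auto
      have "y \<in> D" using y e by auto
      moreover have "kobayashi D w y < \<infinity>" if "kobayashi D w x < \<infinity>"
        using kobayashi_triangle[of D w y x] k that by (auto simp: less_top[symmetric])
      moreover have "kobayashi D w x < \<infinity>" if "kobayashi D w y < \<infinity>"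
        using kobayashi_triangle[of D w x y] k that by (auto simp: less_top[symmetric])
      ultimately show ?thesis using x by (auto simp: S_def)
    qed
    moreover have "ball x (e / 2) \<subseteq> D" using e by auto
    ultimately show ?thesis using half_gt_zero[OF e(1)] by blast
  qed
  have "open S" unfolding open_contains_ball
  proof
    fix x assume x: "x \<in> S"
    hence "x \<in> D" by (simp add: S_def)
    from near[OF this] obtain e where "e > 0" "\<forall>y\<in>ball x e. y \<in> S \<longleftrightarrow> x \<in> S" by metis
    thus "\<exists>e>0. ball x e \<subseteq> S" using x by blast
  qed
  moreover have "open (D - S)" unfolding open_contains_ball
  proof
    fix x assume x: "x \<in> D - S"
    hence "x \<in> D" by simp
    from near[OF this] obtain e where "e > 0" "ball x e \<subseteq> D" "\<forall>y\<in>ball x e. y \<in> S \<longleftrightarrow> x \<in> S" by metis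
    thus "\<exists>e>0. ball x e \<subseteq> D - S" using x by blast
  qed
  moreover have "w \<in> S" using w kobayashi_refl[OF w] by (simp add: S_def)
  ultimately have "S \<inter> D = {} \<or> (D - S) \<inter> D = {}"
    by (intro connectedD[OF con]) auto
  hence "D - S = {}" using w \<open>w \<in> S\<close> by blast
  thus ?thesis using z by (auto simp: S_def)
qed

lemma kobayashi_bounded_on_compact:
  fixes w :: "complex ^ 'n"
  assumes D: "is_domain D" and w: "w \<in> D" and K: "compact K" "K \<subseteq> D"
  shows "\<exists>C. \<forall>z\<in>K. kobayashi D w z \<le> ereal C"
proof -
  have op: "open D" using D by (auto simp: is_domain_def)
  have "\<forall>x\<in>K. \<exists>e>0. ball x e \<subseteq> D" using op K(2) by (meson open_contains_ball subsetD)
  then obtain e where e: "\<And>x. x \<in> K \<Longrightarrow> e x > 0" "\<And>x. x \<in> K \<Longrightarrow> ball x (e x) \<subseteq> D"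
    by metis
  obtain X where X: "X \<subseteq> K" "finite X" "K \<subseteq> (\<Union>x\<in>X. ball x (e x / 2))"
  proof (rule compactE_image[OF K(1), of K "\<lambda>x. ball x (e x / 2)"])
    show "K \<subseteq> (\<Union>x\<in>K. ball x (e x / 2))" using e(1) by force
  qed auto
  define c where "c x = real_of_ereal (kobayashi D w x)" for x
  have c: "kobayashi D w x = ereal (c x)" if "x \<in> K" for x
    using kobayashi_finite[OF D w, of x] kobayashi_nonneg[of D w x] that K(2)
    unfolding c_def by (intro ereal_real'[symmetric]) auto
  have "kobayashi D w z \<le> ereal ((\<Sum>x\<in>X. c x) + artanh (1 / 2))" if z: "z \<in> K" for z
  proof -
    obtain x where x: "x \<in> X" "z \<in> ball x (e x / 2)" using X(3) z by auto
    have "kobayashi D w z \<le> kobayashi D w x + kobayashi D x z" by (rule kobayashi_triangle)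
    also have "\<dots> \<le> ereal (c x) + ereal (artanh (1 / 2))"
      using x X(1) by (intro add_mono kobayashi_ball[OF e(2)]) (auto simp: c)
    \<comment> \<open>A sum of nonnegative terms stands in for their maximum.\<close>
    also have "c x \<le> (\<Sum>x\<in>X. c x)"
      using x X(1,2) kobayashi_nonneg[of D w] by (intro member_le_sum) (auto simp: c_def real_of_ereal_pos)
    finally show ?thesis by simp
  qed
  thus ?thesis by blast
qed

section \<open>Circle means and coordinates\<close>

text \<open>Cauchy's formula at the centre for \<open>Ln (1 + u * w)\<close>, which vanishes there
  and is holomorphic on the closed disc because \<open>1 + u * w\<close> has positive real part. On
  the circle du/u = i dt, so the real part of the logarithm shows up as an imaginary part.\<close>

lemma has_integral_ln_cmod_circle:
  assumes "cmod w < 1"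
  shows "((\<lambda>t. ln (cmod (1 + cis t * w))) has_integral 0) {0..2 * pi}"
proof -
  have ne: "1 + u * w \<notin> \<real>\<^sub>\<le>\<^sub>0" if "cmod u \<le> 1" for u
  proof -
    have "\<bar>Re (u * w)\<bar> \<le> cmod u * cmod w" using abs_Re_le_cmod[of "u * w"] by (simp add: norm_mult)
    also have "\<dots> \<le> 1 * cmod w" using that by (intro mult_right_mono) auto
    also have "\<dots> < 1" using assms by simp
    finally have "0 < Re (1 + u * w)" by simp
    thus ?thesis by (metis complex_nonpos_Reals_iff not_le)
  qed
  have "(\<lambda>u. Ln (1 + u * w)) holomorphic_on cball 0 1"
    using ne by (intro holomorphic_intros) (auto simp: dist_norm)
  hence "((\<lambda>u. Ln (1 + u * w) / (u - 0)) has_contour_integral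
      2 * of_real pi * \<i> * Ln (1 + 0 * w)) (circlepath 0 1)"
    by (intro Cauchy_integral_circlepath_simple) auto
  hence "((\<lambda>t. Ln (1 + cis t * w) / cis t * \<i> * cis t) has_integral 0) {0..2 * pi}"
    by (simp add: circlepath_def has_contour_integral_part_circlepath_iff)
  hence "((\<lambda>t. Im (Ln (1 + cis t * w) / cis t * \<i> * cis t)) has_integral Im 0) {0..2 * pi}"
    by (rule has_integral_Im)
  moreover have "Im (Ln (1 + cis t * w) / cis t * \<i> * cis t) = ln (cmod (1 + cis t * w))" for t
  proof -
    have "1 + cis t * w \<noteq> 0" using ne[of "cis t"] by auto
    thus ?thesis by (simp add: field_simps)
  qed
  ultimately show ?thesis by simp
qed

lemma one_plus_nonzero:
  assumes "cmod w \<le> 1 / 2"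
  shows "1 + w \<noteq> 0"
proof
  assume "1 + w = 0"
  hence "w = -1" by (simp add: eq_neg_iff_add_eq_0 add.commute)
  thus False using assms by simp
qed

lemma ln_cmod_approx:
  assumes "cmod w \<le> 1 / 2"
  shows "\<bar>ln (cmod (1 + w)) - Re w\<bar> \<le> 2 * (cmod w)\<^sup>2"
proof -
  have "\<bar>ln (cmod (1 + w)) - Re w\<bar> \<le> cmod (Ln (1 + w) - w)"
    using abs_Re_le_cmod[of "Ln (1 + w) - w"] one_plus_nonzero[OF assms] by simp
  also have "\<dots> \<le> (cmod w)\<^sup>2 / (1 - cmod w)"
    using assms by (intro Ln_approx_linear) auto
  also have "\<dots> \<le> (cmod w)\<^sup>2 / (1 / 2)"
    using assms by (intro divide_left_mono) auto
  finally show ?thesis by simp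
qed

lemma has_integral_cos_sq: "((\<lambda>t. (cos t)\<^sup>2) has_integral pi) {0..2 * pi}"
proof -
  have "((\<lambda>t. (cos t)\<^sup>2) has_integral
      ((2 * pi) / 2 + sin (2 * pi) * cos (2 * pi) / 2) - (0 / 2 + sin 0 * cos 0 / 2)) {0..2 * pi}"
  proof (rule fundamental_theorem_of_calculus)
    fix t :: real
    have sin: "sin t * sin t = 1 - cos t * cos t"
      using sin_cos_squared_add[of t] by (simp add: power2_eq_square)
    thus "((\<lambda>t. t / 2 + sin t * cos t / 2) has_vector_derivative (cos t)\<^sup>2) (at t within {0..2 * pi})"
      unfolding has_real_derivative_iff_has_vector_derivative[symmetric]
      by (auto intro!: derivative_eq_intros simp: power2_eq_square sin field_simps)
  qed simp
  thus ?thesis by simp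
qed

lemma has_integral_cmod_sq_circle:
  "((\<lambda>t. (cmod (c + s * cis t))\<^sup>2) has_integral 2 * pi * ((cmod c)\<^sup>2 + (cmod s)\<^sup>2)) {0..2 * pi}"
proof -
  \<comment> \<open>\<open>A\<close> and \<open>B\<close> are the real and imaginary parts of
    \<open>c * cnj s\<close>; they give the cross term \<open>2 * A * cos t + 2 * B * sin t\<close>
    of the square.\<close>
  define A where "A = Re c * Re s + Im c * Im s"
  define B where "B = Im c * Re s - Re c * Im s"
  define F where "F t = ((cmod c)\<^sup>2 + (cmod s)\<^sup>2) * t + 2 * A * sin t - 2 * B * cos t" for t
  have "((\<lambda>t. (cmod (c + s * cis t))\<^sup>2) has_integral F (2 * pi) - F 0) {0..2 * pi}"
  proof (rule fundamental_theorem_of_calculus)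
    fix t :: real
    have "(cmod (c + s * cis t))\<^sup>2 =
        (cmod c)\<^sup>2 + (cmod s)\<^sup>2 * ((sin t)\<^sup>2 + (cos t)\<^sup>2) + 2 * A * cos t + 2 * B * sin t"
      unfolding A_def B_def cmod_power2 by (simp add: power2_eq_square) algebra
    hence "(cmod (c + s * cis t))\<^sup>2 = (cmod c)\<^sup>2 + (cmod s)\<^sup>2 + 2 * A * cos t + 2 * B * sin t"
      by simp
    thus "(F has_vector_derivative (cmod (c + s * cis t))\<^sup>2) (at t within {0..2 * pi})"
      unfolding has_real_derivative_iff_has_vector_derivative[symmetric] F_def
      by (auto intro!: derivative_eq_intros)
  qed simp
  thus ?thesis by (simp add: F_def algebra_simps)
qed

section \<open>Polydiscs, coordinate scaling and logarithmic coordinates\<close>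

definition polydisc :: "complex ^ 'n \<Rightarrow> real \<Rightarrow> (complex ^ 'n) set" where
  "polydisc p r = {z. \<forall>j. cmod (z $ j - p $ j) < r}"

lemma open_polydisc: "open (polydisc p r)"
proof -
  have "polydisc p r = (\<Inter>j. {z. cmod (z $ j - p $ j) < r})" by (auto simp: polydisc_def)
  thus ?thesis by (auto intro!: open_INT open_Collect_less continuous_intros)
qed

lemma open_contains_polydisc:
  assumes "open S" "p \<in> S"
  shows "\<exists>r>0. polydisc p r \<subseteq> S"
proof -
  obtain e where e: "e > 0" "ball p e \<subseteq> S" using assms by (meson open_contains_ball)
  define r where "r = e / real CARD('a)"
  have "z \<in> ball p e" if "z \<in> polydisc p r" for z
  proof -
    have "norm (z - p) \<le> (\<Sum>j\<in>UNIV. cmod ((z - p) $ j))"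
      unfolding norm_vec_def by (rule L2_set_le_sum) auto
    also have "\<dots> < (\<Sum>j\<in>(UNIV::'a set). r)"
      using that by (intro sum_strict_mono) (auto simp: polydisc_def)
    also have "\<dots> = e" by (simp add: r_def)
    finally show ?thesis by (simp add: dist_norm norm_minus_commute)
  qed
  moreover have "r > 0" using e by (simp add: r_def)
  ultimately show ?thesis using e(2) by blast
qed

lemma norm_vec_le:
  fixes x y :: "complex ^ 'n"
  assumes "\<And>j. cmod (x $ j) \<le> cmod (y $ j)"
  shows "norm x \<le> norm y"
  unfolding norm_vec_def by (rule L2_set_mono) (use assms in auto)

text \<open>For |c| \<le> 1 these points sweep the disc that completeness in coordinate
  \<open>i\<close> requires; \<open>c = 0\<close> is the projection onto the hyperplane.\<close>

definition scale_coord :: "'n \<Rightarrow> complex \<Rightarrow> complex ^ 'n \<Rightarrow> complex ^ 'n" where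
  "scale_coord i c z = (\<chi> j. if j = i then c * z $ j else z $ j)"

lemma continuous_on_scale_coord [continuous_intros]:
  assumes "continuous_on S f" "continuous_on S g"
  shows "continuous_on S (\<lambda>x. scale_coord i (f x) (g x))"
proof -
  have "continuous_on S (\<lambda>x. if j = i then f x * g x $ j else g x $ j)" for j
    using assms by (cases "j = i") (auto intro!: continuous_intros)
  thus ?thesis unfolding scale_coord_def by (intro continuous_intros)
qed

lemma dist_scale_coord_le:
  assumes "cmod c \<le> 1"
  shows "dist (scale_coord i c z) (scale_coord i c w) \<le> dist z w"
  unfolding dist_norm
proof (rule norm_vec_le)
  fix j
  show "cmod ((scale_coord i c z - scale_coord i c w) $ j) \<le> cmod ((z - w) $ j)"
    using assms
    by (auto simp: scale_coord_def norm_mult mult_left_le_one_le simp flip: right_diff_distrib)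
qed

definition exp_vec :: "real ^ 'n \<Rightarrow> complex ^ 'n" where
  "exp_vec x = (\<chi> j. of_real (exp (x $ j)))"

text \<open>Meaningful only off the coordinate hyperplanes, where it inverts \<open>exp_vec\<close>
  up to rotation of each coordinate.\<close>

definition ln_vec :: "complex ^ 'n \<Rightarrow> real ^ 'n" where
  "ln_vec z = (\<chi> j. ln (cmod (z $ j)))"

lemma ln_vec_exp_vec [simp]: "ln_vec (exp_vec x) = x"
  by (simp add: ln_vec_def exp_vec_def vec_eq_iff)

lemma continuous_on_exp_vec: "continuous_on S exp_vec"
  unfolding exp_vec_def by (intro continuous_intros)

lemma has_integral_vec:
  fixes f :: "real \<Rightarrow> real ^ 'n"
  assumes "\<And>j. ((\<lambda>t. f t $ j) has_integral I $ j) S"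
  shows "(f has_integral I) S"
  unfolding has_integral_componentwise_iff[of f]
  using assms by (auto simp: Basis_vec_def inner_axis)

text \<open>The real part is (1 - |\<xi>|^2) / |1 - \<xi>|^2.\<close>

lemma Re_cayley_pos:
  assumes "cmod \<xi> < 1"
  shows "0 < Re ((1 + \<xi>) / (1 - \<xi>))"
proof -
  have "(cmod \<xi>)\<^sup>2 < 1" using assms by (simp add: abs_square_less_1)
  hence sq: "(Re \<xi>)\<^sup>2 + (Im \<xi>)\<^sup>2 < 1" by (simp add: cmod_power2)
  moreover have "1 - \<xi> \<noteq> 0" using assms by auto
  hence "0 < (Re (1 - \<xi>))\<^sup>2 + (Im (1 - \<xi>))\<^sup>2"
    by (metis complex_neq_0)
  ultimately show ?thesis unfolding Re_divide
    by (intro divide_pos_pos) (simp_all add: power2_eq_square algebra_simps)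
qed

section \<open>Completeness\<close>

text \<open>\<open>frontier_nonempty\<close> excludes \<open>D = UNIV\<close>, where
  \<open>infdist\<close> to the empty frontier is 0 by convention. In the theorem it comes from the
  point \<open>\<zeta>0\<close>.\<close>

locale pseudoconvex_reinhardt =
  fixes D :: "(complex ^ 'n) set"
  assumes domain: "is_domain D" and reinhardt: "reinhardt D" and pseudoconvex: "pseudoconvex D"
    and frontier_nonempty: "frontier D \<noteq> {}"
begin

section \<open>Boundary distance, sub-mean values and torus invariance\<close>

abbreviation u :: "complex ^ 'n \<Rightarrow> real" where
  "u z \<equiv> - ln (bdry_dist D z)"

lemma open_D: "open D" and connected_D: "connected D"
  using domain by (auto simp: is_domain_def)

lemma frontier_disjoint: "p \<in> frontier D \<Longrightarrow> p \<notin> D"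
  using open_D by (simp add: frontier_def interior_open)

lemma bdry_dist_pos: "z \<in> D \<Longrightarrow> 0 < bdry_dist D z"
  unfolding bdry_dist_def
  using frontier_nonempty frontier_disjoint by (intro infdist_pos_not_in_closed) auto

lemma bdry_dist_lipschitz: "bdry_dist D w \<le> bdry_dist D z + dist z w"
  unfolding bdry_dist_def using infdist_triangle[of w "frontier D" z] by (simp add: dist_commute)

lemma less_bdry_dist_imp_mem:
  assumes "z \<in> D" "dist z w < bdry_dist D z"
  shows "w \<in> D"
proof (rule ccontr)
  assume "w \<notin> D"
  hence "closed_segment z w \<inter> frontier D \<noteq> {}"
    using assms(1) by (intro connected_Int_frontier) auto
  then obtain p where p: "p \<in> closed_segment z w" "p \<in> frontier D" by blast
  have "bdry_dist D z \<le> dist z p" unfolding bdry_dist_def by (rule infdist_le[OF p(2)])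
  also have "\<dots> \<le> dist z w"
    using dist_in_closed_segment[OF p(1)] by (simp add: dist_commute)
  finally show False using assms(2) by simp
qed

lemma continuous_on_u: "continuous_on D u"
  using bdry_dist_pos less_imp_neq unfolding bdry_dist_def
  by (intro continuous_intros continuous_on_infdist) fastforce

text \<open>Only a majorant \<open>\<psi>\<close> of \<open>u\<close> on the circle has to be
  integrated explicitly; integrability of \<open>u\<close> itself is part of
  \<open>plurisubharmonic_on\<close>.\<close>

lemma submean:
  assumes disc: "\<And>\<xi>. cmod \<xi> \<le> 1 \<Longrightarrow> a + \<xi> *s b \<in> D"
    and psi: "(\<psi> has_integral I) {0..2 * pi}"
    and le: "\<And>t. u (a + cis t *s b) \<le> \<psi> t"
  shows "2 * pi * u a \<le> I"
proof -
  have "D \<noteq> UNIV" using frontier_nonempty by auto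
  hence "plurisubharmonic_on D u" using pseudoconvex by (simp add: pseudoconvex_def)
  hence int: "(\<lambda>t. u (a + cis t *s b)) absolutely_integrable_on {0..2 * pi}"
    and mean: "u a \<le> 1 / (2 * pi) * integral {0..2 * pi} (\<lambda>t. u (a + cis t *s b))"
    using disc unfolding plurisubharmonic_on_def by auto
  have "integral {0..2 * pi} (\<lambda>t. u (a + cis t *s b)) \<le> integral {0..2 * pi} \<psi>"
    using int psi le
    by (intro integral_le) (auto intro: set_lebesgue_integral_eq_integral(1) has_integral_integrable)
  also have "\<dots> = I" using psi by (rule integral_unique)
  finally show ?thesis using mean by (simp add: field_simps)
qed

lemma mem_if_same_moduli:
  assumes "z \<in> D" "\<And>j. cmod (w $ j) = cmod (z $ j)"
  shows "w \<in> D"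
proof -
  define l :: "complex ^ 'n" where "l = (\<chi> j. if z $ j = 0 then 1 else w $ j / z $ j)"
  have "(\<chi> j. l $ j * z $ j) = w"
    using assms(2) by (auto simp: l_def vec_eq_iff) (metis norm_eq_zero)
  moreover have "\<forall>j. cmod (l $ j) = 1" using assms(2) by (auto simp: l_def norm_divide)
  ultimately show ?thesis using reinhardt assms(1) unfolding reinhardt_def by metis
qed

text \<open>The rotation \<open>l\<close> taking \<open>w\<close> to \<open>z\<close> is an isometry
  preserving \<open>D\<close>. A frontier point nearer to \<open>w\<close> than
  \<open>bdry_dist D z\<close> would be rotated into \<open>D\<close>, hence lie in
  \<open>D\<close>.\<close>

lemma bdry_dist_le_same_moduli:
  assumes "z \<in> D" and zw: "\<And>j. cmod (w $ j) = cmod (z $ j)"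
  shows "bdry_dist D z \<le> bdry_dist D w"
proof -
  define l :: "complex ^ 'n" where "l = (\<chi> j. if z $ j = 0 then 1 else z $ j / w $ j)"
  have z: "(\<chi> j. l $ j * w $ j) = z"
    using zw by (auto simp: l_def vec_eq_iff) (metis norm_eq_zero)+
  have l: "cmod (l $ j) = 1" for j using zw by (auto simp: l_def norm_divide)
  have "bdry_dist D z \<le> dist w p" if p: "p \<in> frontier D" for p
  proof (rule ccontr)
    assume less: "\<not> bdry_dist D z \<le> dist w p"
    define q where "q = (\<chi> j. l $ j * p $ j)"
    have "dist z q \<le> dist w p" unfolding dist_norm
    proof (rule norm_vec_le)
      fix j
      have "(z - q) $ j = l $ j * (w - p) $ j"
        by (subst z[symmetric]) (simp add: q_def right_diff_distrib)
      thus "cmod ((z - q) $ j) \<le> cmod ((w - p) $ j)" by (simp add: norm_mult l)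
    qed
    hence "q \<in> D" using less by (intro less_bdry_dist_imp_mem[OF assms(1)]) simp
    hence "p \<in> D" by (rule mem_if_same_moduli) (simp add: q_def norm_mult l)
    thus False using p frontier_disjoint by blast
  qed
  thus ?thesis unfolding bdry_dist_def[of D w] infdist_def
    using frontier_nonempty by (auto intro: cINF_greatest)
qed

lemma u_eq_same_moduli:
  assumes "z \<in> D" "\<And>j. cmod (w $ j) = cmod (z $ j)"
  shows "u w = u z"
  using bdry_dist_le_same_moduli[OF assms]
    bdry_dist_le_same_moduli[OF mem_if_same_moduli[OF assms], of z] assms(2) by simp

text \<open>The maximum principle for \<open>c \<mapsto> u (scale_coord i c z)\<close> on the unit disc; on the unit circle this
  function is constant by torus invariance. Adding \<open>|c|\<^sup>2\<close> makes the sub-mean value inequality strict and costs the \<open>1\<close>.\<close>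

lemma u_scale_coord_le:
  assumes disc: "\<And>c. cmod c \<le> 1 \<Longrightarrow> scale_coord i c z \<in> D" and c: "cmod c \<le> 1"
  shows "u (scale_coord i c z) \<le> u z + 1"
proof -
  define G where "G c = u (scale_coord i c z) + (cmod c)\<^sup>2" for c
  have "continuous_on (cball 0 1) (\<lambda>c. u (scale_coord i c z))"
    using disc by (intro continuous_on_compose2[OF continuous_on_u] continuous_intros) auto
  hence "continuous_on (cball 0 1) G"
    unfolding G_def by (intro continuous_on_add continuous_on_power continuous_on_norm_id)
  then obtain m where m: "cmod m \<le> 1" "\<And>c. cmod c \<le> 1 \<Longrightarrow> G c \<le> G m"
    using continuous_attains_sup[of "cball 0 1 :: complex set" G] by auto
  show ?thesis
  proof (cases "cmod m = 1")
    case True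
    have "z = scale_coord i 1 z" by (simp add: scale_coord_def vec_eq_iff)
    hence "z \<in> D" using disc[of 1] by simp
    hence "u (scale_coord i m z) = u z"
      by (rule u_eq_same_moduli) (simp add: scale_coord_def norm_mult True)
    thus ?thesis using m(2)[OF c] by (simp add: G_def True) (smt (verit) zero_le_power2)
  next
    case False
    \<comment> \<open>The disc of radius \<open>s\<close> about \<open>m\<close> is the largest one
      inside the closed unit disc.\<close>
    define s where "s = 1 - cmod m"
    have s: "s > 0" using False m(1) by (simp add: s_def)
    define b :: "complex ^ 'n" where "b = (\<chi> j. if j = i then of_real s * z $ i else 0)"
    have eq: "scale_coord i m z + \<xi> *s b = scale_coord i (m + of_real s * \<xi>) z" for \<xi>
      by (auto simp: scale_coord_def b_def vec_eq_iff algebra_simps)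
    have cm: "cmod (m + of_real s * \<xi>) \<le> 1" if "cmod \<xi> \<le> 1" for \<xi>
    proof -
      have "cmod (of_real s * \<xi>) \<le> s" using that s by (simp add: norm_mult)
      thus ?thesis using norm_triangle_ineq[of m "of_real s * \<xi>"] by (simp add: s_def)
    qed
    have "2 * pi * u (scale_coord i m z) \<le> 2 * pi * G m - 2 * pi * ((cmod m)\<^sup>2 + (cmod (of_real s))\<^sup>2)"
    proof (rule submean[where b = b])
      show "((\<lambda>t. G m - (cmod (m + of_real s * cis t))\<^sup>2) has_integral
          2 * pi * G m - 2 * pi * ((cmod m)\<^sup>2 + (cmod (of_real s))\<^sup>2)) {0..2 * pi}"
        using has_integral_const_real[of "G m" 0 "2 * pi"]
        by (intro has_integral_diff has_integral_cmod_sq_circle) simp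
    next
      fix t show "u (scale_coord i m z + cis t *s b) \<le> G m - (cmod (m + of_real s * cis t))\<^sup>2"
        using m(2)[OF cm[of "cis t"]] by (simp add: G_def eq)
    qed (simp add: eq disc cm)
    \<comment> \<open>|c|^2 has mean |m|^2 + s^2 on the circle, so at the maximum \<open>m\<close>
      of \<open>G\<close> the inequality bounds \<open>u\<close> by itself minus
      \<open>s\<^sup>2\<close>.\<close>
    hence "2 * pi * s\<^sup>2 \<le> 0" by (simp add: G_def algebra_simps)
    thus ?thesis using s pi_gt_zero by (simp add: mult_le_0_iff power2_eq_square)
  qed
qed

text \<open>The set \<open>A\<close> of points whose whole disc lies in \<open>D\<close> contains
  \<open>p\<close>, which scaling fixes. By \<open>u_scale_coord_le\<close> the boundary distance
  along such a disc is at least 1/e times that at its base point, so the disc can be moved by that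
  amount; this makes \<open>A\<close> and \<open>D - A\<close> open.\<close>

lemma scale_coord_mem:
  assumes p: "p \<in> D" "p $ i = 0" and z: "z \<in> D" and c: "cmod c \<le> 1"
  shows "scale_coord i c z \<in> D"
proof -
  define A where "A = {z \<in> D. \<forall>c. cmod c \<le> 1 \<longrightarrow> scale_coord i c z \<in> D}"
  have spread: "z \<in> A" if z': "z' \<in> A" and "dist z' z < exp (-1) * bdry_dist D z'" for z z'
  proof -
    have "z' \<in> D" using z' by (simp add: A_def)
    have *: "scale_coord i c z \<in> D" if c: "cmod c \<le> 1" for c
    proof -
      have mem: "scale_coord i c z' \<in> D" using z' c by (simp add: A_def)
      have "- ln (bdry_dist D (scale_coord i c z')) \<le> - ln (bdry_dist D z') + 1"
        by (rule u_scale_coord_le[OF _ c]) (use z' in \<open>simp add: A_def\<close>)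
      hence "ln (exp (-1) * bdry_dist D z') \<le> ln (bdry_dist D (scale_coord i c z'))"
        using bdry_dist_pos[OF \<open>z' \<in> D\<close>] by (simp add: ln_mult)
      hence "exp (-1) * bdry_dist D z' \<le> bdry_dist D (scale_coord i c z')"
        using bdry_dist_pos[OF \<open>z' \<in> D\<close>] bdry_dist_pos[OF mem] by simp
      thus ?thesis
        using that dist_scale_coord_le[OF c, of i z' z] \<open>dist z' z < _\<close>
        by (intro less_bdry_dist_imp_mem[OF mem]) linarith
    qed
    moreover have "scale_coord i 1 z = z" by (simp add: scale_coord_def vec_eq_iff)
    ultimately show ?thesis using *[of 1] by (simp add: A_def)
  qed
  have "open A" unfolding open_contains_ball
  proof
    fix z' assume z': "z' \<in> A"
    hence "exp (-1) * bdry_dist D z' > 0" using bdry_dist_pos by (simp add: A_def)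
    thus "\<exists>e>0. ball z' e \<subseteq> A" using spread[OF z'] by (metis mem_ball subsetI)
  qed
  moreover have "open (D - A)" unfolding open_contains_ball
  proof
    fix z assume z: "z \<in> D - A"
    \<comment> \<open>With a quarter of the distance, every \<open>z'\<close> in the ball has
      boundary distance at least \<open>3 * e\<close>. As exp (-1) \<ge> 1/3, a disc based at
      \<open>z'\<close> could be moved to \<open>z\<close>, so \<open>z'\<close> in \<open>A\<close>
      would force \<open>z\<close> in \<open>A\<close>.\<close>
    define e where "e = bdry_dist D z / 4"
    have e: "e > 0" using bdry_dist_pos z by (simp add: e_def)
    have "z' \<in> D - A" if z': "z' \<in> ball z e" for z'
    proof -
      have d: "dist z z' < e" using z' by simp
      have "bdry_dist D z \<le> bdry_dist D z' + dist z z'"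
        using bdry_dist_lipschitz[of z z'] by (simp add: dist_commute)
      hence "3 * e \<le> bdry_dist D z'" using d by (simp add: e_def)
      moreover have "exp (-1) \<ge> (1 / 3 :: real)"
        using e_less_272 by (simp add: exp_minus field_simps)
      ultimately have "1 / 3 * (3 * e) \<le> exp (-1) * bdry_dist D z'"
        using e by (intro mult_mono) auto
      hence "dist z' z < exp (-1) * bdry_dist D z'" using d by (simp add: dist_commute)
      hence "z' \<notin> A" using spread z by blast
      moreover have "z' \<in> D"
        proof (rule less_bdry_dist_imp_mem[of z])
        show "dist z z' < bdry_dist D z" using d e by (simp add: e_def)
      qed (use z in simp)
      ultimately show ?thesis by blast
    qed
    thus "\<exists>e>0. ball z e \<subseteq> D - A" using e by blast
  qed
  moreover have "p \<in> A"
  proof -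
    have "scale_coord i c p = p" for c using p by (auto simp: scale_coord_def vec_eq_iff)
    thus ?thesis using p by (simp add: A_def)
  qed
  ultimately have "A \<inter> D = {} \<or> (D - A) \<inter> D = {}"
    by (intro connectedD[OF connected_D]) auto
  hence "z \<in> A" using z p(1) \<open>p \<in> A\<close> by blast
  thus ?thesis using c by (simp add: A_def)
qed

section \<open>Logarithmic convexity\<close>

text \<open>By torus invariance it is enough to test the positive point of each torus: this is the
  set of \<open>ln_vec z\<close> over the \<open>z\<close> in \<open>D\<close> with no zero
  coordinate.\<close>

definition log_image :: "(real ^ 'n) set" where
  "log_image = {x. exp_vec x \<in> D}"

abbreviation \<phi> :: "real ^ 'n \<Rightarrow> real" where
  "\<phi> x \<equiv> u (exp_vec x)"

lemma open_log_image: "open log_image"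
proof -
  have "log_image = exp_vec -` D" by (auto simp: log_image_def)
  thus ?thesis using open_vimage[OF open_D continuous_on_exp_vec] by simp
qed

lemma continuous_on_phi: "continuous_on log_image \<phi>"
  by (intro continuous_on_compose2[OF continuous_on_u continuous_on_exp_vec]) (auto simp: log_image_def)

lemma ln_vec_mem_log_image_iff:
  assumes "\<And>j. z $ j \<noteq> 0"
  shows "ln_vec z \<in> log_image \<longleftrightarrow> z \<in> D"
proof -
  have "cmod (exp_vec (ln_vec z) $ j) = cmod (z $ j)" for j
    using assms by (simp add: exp_vec_def ln_vec_def)
  thus ?thesis unfolding log_image_def using mem_if_same_moduli by (metis mem_Collect_eq)
qed

text \<open>A quadratic polynomial touching \<open>\<phi>\<close> from above cannot be strictly concave in any direction: the
  complex line tangent to \<open>t \<mapsto> exp (q + t v)\<close> meets \<open>\<phi>\<close> in points whose logarithmic moduli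
  \<open>q\<^sub>j + ln |1 + \<rho> v\<^sub>j e\<^sup>i\<^sup>t|\<close> average to \<open>q\<close> and equal \<open>q + \<rho> (cos t) v\<close> up to \<open>O(\<rho>\<^sup>2)\<close>.\<close>

lemma no_concave_touching:
  fixes v :: "real ^ 'n" and l T :: "real ^ 'n \<Rightarrow> real" and R :: "real ^ 'n \<Rightarrow> real ^ 'n"
  assumes \<delta>: "\<delta> > 0" "ball q \<delta> \<subseteq> log_image"
    and lin: "bounded_linear l" "bounded_linear T" "bounded_linear R"
    and T: "T v = 1" and R: "R v = 0" and M: "M \<ge> 0"
    and le: "\<And>h. norm h < \<delta> \<Longrightarrow> \<phi> (q + h) \<le> \<phi> q + l h - (T h)\<^sup>2 + M * (norm (R h))\<^sup>2"
  shows False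
proof -
  obtain KT where KT: "KT > 0" "\<And>h. norm (T h) \<le> norm h * KT"
    using bounded_linear.pos_bounded[OF lin(2)] by blast
  obtain KR where KR: "KR > 0" "\<And>h. norm (R h) \<le> norm h * KR"
    using bounded_linear.pos_bounded[OF lin(3)] by blast
  define V where "V = (\<Sum>j\<in>UNIV. \<bar>v $ j\<bar>)"
  have V: "V \<ge> 0" "\<bar>v $ j\<bar> \<le> V" for j
    unfolding V_def by (auto intro!: sum_nonneg member_le_sum)
  define K where "K = (\<Sum>j\<in>(UNIV::'n set). 2 * V\<^sup>2)"
  have K: "K \<ge> 0" unfolding K_def by (intro sum_nonneg) simp
  \<comment> \<open>\<open>K2 * \<rho> ^ 3\<close> will absorb the cross term of
    \<open>(T h)\<^sup>2\<close>, of order \<rho>^3, and the \<open>M\<close> term, of order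
    \<rho>^4.\<close>
  define K2 where "K2 = 2 * (K * KT) + M * (K * KR)\<^sup>2"
  have K2: "K2 \<ge> 0" using K KT KR M by (simp add: K2_def)
  \<comment> \<open>In turn, the bounds on \<rho> let higher powers be dominated by lower ones, keep
    the logarithms within reach of \<open>ln_cmod_approx\<close>, keep \<open>h\<close> inside the
    ball, and make the cubic error smaller than the quadratic gain.\<close>
  define \<rho> where "\<rho> = min (min (1 / 2) (1 / (2 * (V + 1))))
    (min (\<delta> / (2 * (norm v + K + 1))) (1 / (4 * (K2 + 1))))"
  have "\<rho> > 0"
    using \<delta>(1) V(1) K K2 norm_ge_zero[of v]
    by (auto simp: \<rho>_def intro!: divide_pos_pos add_nonneg_pos)
  moreover have "\<rho> \<le> 1 / 2" "\<rho> \<le> 1 / (2 * (V + 1))"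
      "\<rho> \<le> \<delta> / (2 * (norm v + K + 1))" "\<rho> \<le> 1 / (4 * (K2 + 1))"
    unfolding \<rho>_def by (meson min.cobounded1 min.cobounded2 order_trans)+
  ultimately have rho: "\<rho> > 0" "\<rho> \<le> 1 / 2" "\<rho> \<le> 1 / (2 * (V + 1))"
      "\<rho> \<le> \<delta> / (2 * (norm v + K + 1))" "\<rho> \<le> 1 / (4 * (K2 + 1))" .
  have rhoV: "\<rho> * V \<le> 1 / 2"
  proof -
    have "\<rho> * V \<le> 1 / (2 * (V + 1)) * V" using rho V by (intro mult_right_mono) auto
    also have "\<dots> \<le> 1 / 2" using V(1) by (simp add: field_simps)
    finally show ?thesis .
  qed
  have rhod: "\<rho> * (norm v + K) < \<delta>"
  proof -
    have "\<rho> * (norm v + K) \<le> \<delta> / (2 * (norm v + K + 1)) * (norm v + K)"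
      using rho K by (intro mult_right_mono) auto
    also have "\<dots> < \<delta>" using \<delta>(1) K by (simp add: divide_less_eq add_nonneg_pos algebra_simps)
        (smt (verit) mult_nonneg_nonneg norm_ge_zero)
    finally show ?thesis .
  qed
  \<comment> \<open>The displacement of the logarithmic moduli, relative to \<open>q\<close>, at the
    point \<open>\<xi>\<close> of the tangent disc.\<close>
  define h where "h \<xi> = (\<chi> j. ln (cmod (1 + \<xi> * of_real (\<rho> * v $ j))))" for \<xi> :: complex
  have small: "cmod (\<xi> * of_real (\<rho> * v $ j)) \<le> \<rho> * V" if "cmod \<xi> \<le> 1" for \<xi> j
  proof -
    have "cmod \<xi> * (\<rho> * \<bar>v $ j\<bar>) \<le> 1 * (\<rho> * V)"
      using that V rho by (intro mult_mono) auto
    thus ?thesis using rho by (simp add: norm_mult abs_mult)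
  qed
  have err: "norm (h \<xi> - (\<rho> * Re \<xi>) *\<^sub>R v) \<le> \<rho>\<^sup>2 * K" if \<xi>: "cmod \<xi> \<le> 1" for \<xi>
  proof -
    have "\<bar>(h \<xi> - (\<rho> * Re \<xi>) *\<^sub>R v) $ j\<bar> \<le> \<rho>\<^sup>2 * (2 * V\<^sup>2)" for j
    proof -
      have "cmod (\<xi> * of_real (\<rho> * v $ j)) \<le> 1 / 2" using small[OF \<xi>] rhoV order_trans by blast
      from ln_cmod_approx[OF this]
      have "\<bar>(h \<xi> - (\<rho> * Re \<xi>) *\<^sub>R v) $ j\<bar> \<le> 2 * (cmod (\<xi> * of_real (\<rho> * v $ j)))\<^sup>2"
        by (simp add: h_def mult.assoc mult.left_commute mult.commute)
      also have "\<dots> \<le> 2 * (\<rho> * V)\<^sup>2" using small[OF \<xi>] by (intro mult_left_mono power_mono) auto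
      finally show ?thesis by (simp add: power_mult_distrib mult_ac)
    qed
    hence "(\<Sum>j\<in>UNIV. \<bar>(h \<xi> - (\<rho> * Re \<xi>) *\<^sub>R v) $ j\<bar>) \<le> (\<Sum>j\<in>(UNIV::'n set). \<rho>\<^sup>2 * (2 * V\<^sup>2))"
      by (intro sum_mono)
    thus ?thesis using norm_le_l1_cart[of "h \<xi> - (\<rho> * Re \<xi>) *\<^sub>R v"]
      unfolding K_def sum_distrib_left by linarith
  qed
  have hd: "norm (h \<xi>) < \<delta>" if \<xi>: "cmod \<xi> \<le> 1" for \<xi>
  proof -
    have "norm (h \<xi>) \<le> norm ((\<rho> * Re \<xi>) *\<^sub>R v) + norm (h \<xi> - (\<rho> * Re \<xi>) *\<^sub>R v)"
      by (metis norm_triangle_ineq add_diff_cancel_left' diff_add_cancel add.commute)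
    also have "norm ((\<rho> * Re \<xi>) *\<^sub>R v) \<le> \<rho> * norm v"
    proof -
      have "\<bar>Re \<xi>\<bar> \<le> 1" using \<xi> abs_Re_le_cmod order_trans by blast
      hence "\<rho> * \<bar>Re \<xi>\<bar> * norm v \<le> \<rho> * 1 * norm v"
        using rho by (intro mult_right_mono mult_left_mono) auto
      thus ?thesis using rho by (simp add: abs_mult)
    qed
    also have "norm (h \<xi> - (\<rho> * Re \<xi>) *\<^sub>R v) \<le> \<rho> * K"
    proof -
      have "\<rho>\<^sup>2 * K \<le> \<rho> * K" using rho K by (intro mult_right_mono) (auto simp: power2_eq_square mult_left_le)
      thus ?thesis using err[OF \<xi>] by simp
    qed
    finally show ?thesis using rhod by (simp add: distrib_left)
  qed
  \<comment> \<open>The derivative at t = 0 of \<open>exp_vec (q + t v)\<close> along the direction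
    v scaled by \<rho>.\<close>
  define b where "b = (\<chi> j. of_real (\<rho> * v $ j) * exp_vec q $ j)"
  have mod: "cmod ((exp_vec q + \<xi> *s b) $ j) = cmod (exp_vec (q + h \<xi>) $ j)" if \<xi>: "cmod \<xi> \<le> 1" for \<xi> j
  proof -
    have "cmod (\<xi> * of_real (\<rho> * v $ j)) \<le> 1 / 2" using small[OF \<xi>] rhoV order_trans by blast
    hence "1 + \<xi> * of_real (\<rho> * v $ j) \<noteq> 0"
      by (rule one_plus_nonzero)
    hence "cmod (exp_vec (q + h \<xi>) $ j) = exp (q $ j) * cmod (1 + \<xi> * of_real (\<rho> * v $ j))"
      by (simp add: exp_vec_def h_def exp_add del: of_real_mult)
    also have "\<dots> = cmod ((exp_vec q + \<xi> *s b) $ j)"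
    proof -
      have "(exp_vec q + \<xi> *s b) $ j = of_real (exp (q $ j)) * (1 + \<xi> * of_real (\<rho> * v $ j))"
        by (simp add: exp_vec_def b_def algebra_simps)
      thus ?thesis by (simp add: norm_mult del: of_real_mult)
    qed
    finally show ?thesis by simp
  qed
  have inL: "q + h \<xi> \<in> log_image" if "cmod \<xi> \<le> 1" for \<xi>
    using \<delta>(2) hd[OF that] by (auto simp: dist_norm)
  \<comment> \<open>The linear term integrates to 0 because each coordinate of \<open>h\<close> has
    mean 0, and the concave term contributes -\<rho>^2 \<pi>. What remains is of order \<rho>^3, too
    small to compensate.\<close>
  have "2 * pi * u (exp_vec q) \<le> 2 * pi * \<phi> q + 0 - \<rho>\<^sup>2 * pi + 2 * pi * (K2 * \<rho> ^ 3)"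
  proof (rule submean[where b = b])
    fix \<xi> :: complex assume \<xi>: "cmod \<xi> \<le> 1"
    show "exp_vec q + \<xi> *s b \<in> D"
      by (rule mem_if_same_moduli[OF _ mod[OF \<xi>]]) (use inL[OF \<xi>] in \<open>simp add: log_image_def\<close>)
  next
    have "((\<lambda>t. h (cis t)) has_integral 0) {0..2 * pi}"
    proof (rule has_integral_vec)
      fix j
      have "cmod (of_real (\<rho> * v $ j)) < 1" using small[of 1 j] rhoV by simp
      from has_integral_ln_cmod_circle[OF this]
      show "((\<lambda>t. h (cis t) $ j) has_integral 0 $ j) {0..2 * pi}" by (simp add: h_def)
    qed
    from has_integral_linear[OF this lin(1)]
    have "((\<lambda>t. l (h (cis t))) has_integral 0) {0..2 * pi}"
      by (simp add: o_def linear_0 bounded_linear.linear[OF lin(1)])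
    thus "((\<lambda>t. \<phi> q + l (h (cis t)) - \<rho>\<^sup>2 * (cos t)\<^sup>2 + K2 * \<rho> ^ 3) has_integral
        2 * pi * \<phi> q + 0 - \<rho>\<^sup>2 * pi + 2 * pi * (K2 * \<rho> ^ 3)) {0..2 * pi}"
      using has_integral_const_real[of "\<phi> q" 0 "2 * pi"] has_integral_const_real[of "K2 * \<rho> ^ 3" 0 "2 * pi"]
      by (intro has_integral_add has_integral_diff has_integral_mult_right has_integral_cos_sq) simp_all
  next
    fix t :: real
    have t: "cmod (cis t) \<le> 1" by simp
    define e where "e = h (cis t) - (\<rho> * cos t) *\<^sub>R v"
    have e: "norm e \<le> \<rho>\<^sup>2 * K" using err[OF t] by (simp add: e_def)
    have he: "h (cis t) = (\<rho> * cos t) *\<^sub>R v + e" by (simp add: e_def)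
    have Th: "T (h (cis t)) = \<rho> * cos t + T e"
      unfolding he using lin(2) by (simp add: linear_add linear_scale bounded_linear.linear T)
    have Rh: "R (h (cis t)) = R e"
      unfolding he using lin(3) by (simp add: linear_add linear_scale bounded_linear.linear R)
    have "norm e * KT \<le> \<rho>\<^sup>2 * K * KT" using e KT(1) by (intro mult_right_mono) auto
    hence Te: "\<bar>T e\<bar> \<le> \<rho>\<^sup>2 * (K * KT)"
      using KT(2)[of e] by (simp add: mult.assoc)
    have "norm e * KR \<le> \<rho>\<^sup>2 * K * KR" using e KR(1) by (intro mult_right_mono) auto
    hence Re: "norm (R e) \<le> \<rho>\<^sup>2 * (K * KR)"
      using KR(2)[of e] by (simp add: mult.assoc)
    have "(T (h (cis t)))\<^sup>2 \<ge> \<rho>\<^sup>2 * (cos t)\<^sup>2 - 2 * (\<rho> * (\<rho>\<^sup>2 * (K * KT)))"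
    proof -
      have "\<bar>\<rho> * cos t * T e\<bar> \<le> \<rho> * (\<rho>\<^sup>2 * (K * KT))"
      proof -
        have "\<rho> * (\<bar>cos t\<bar> * \<bar>T e\<bar>) \<le> \<rho> * (1 * (\<rho>\<^sup>2 * (K * KT)))"
          using Te rho by (intro mult_left_mono mult_mono) auto
        thus ?thesis using rho by (simp add: abs_mult mult.assoc)
      qed
      moreover have "(\<rho> * cos t + T e)\<^sup>2 = \<rho>\<^sup>2 * (cos t)\<^sup>2 + 2 * (\<rho> * cos t * T e) + (T e)\<^sup>2"
        by (simp add: power2_eq_square algebra_simps)
      moreover have "(T e)\<^sup>2 \<ge> 0" by simp
      ultimately show ?thesis unfolding Th by linarith
    qed
    moreover have "M * (norm (R (h (cis t))))\<^sup>2 \<le> M * ((K * KR)\<^sup>2 * \<rho> ^ 3)"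
    proof -
      have "(norm (R e))\<^sup>2 \<le> (\<rho>\<^sup>2 * (K * KR))\<^sup>2" using Re by (intro power_mono) auto
      also have "\<dots> = \<rho> ^ 4 * (K * KR)\<^sup>2" by (simp add: power_mult_distrib)
      also have "\<dots> \<le> \<rho> ^ 3 * (K * KR)\<^sup>2"
        using rho by (intro mult_right_mono power_decreasing) auto
      finally show ?thesis unfolding Rh using M by (intro mult_left_mono) (auto simp: mult_ac)
    qed
    moreover have "\<phi> (q + h (cis t)) \<le> \<phi> q + l (h (cis t)) - (T (h (cis t)))\<^sup>2 + M * (norm (R (h (cis t))))\<^sup>2"
      by (rule le[OF hd[OF t]])
    moreover have "u (exp_vec q + cis t *s b) = \<phi> (q + h (cis t))"
      by (rule u_eq_same_moduli[OF _ mod[OF t]]) (use inL[OF t] in \<open>simp add: log_image_def\<close>)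
    moreover have "K2 * \<rho> ^ 3 = 2 * (\<rho> * (\<rho>\<^sup>2 * (K * KT))) + M * ((K * KR)\<^sup>2 * \<rho> ^ 3)"
      by (simp add: K2_def power2_eq_square power3_eq_cube algebra_simps)
    ultimately show "u (exp_vec q + cis t *s b) \<le> \<phi> q + l (h (cis t)) - \<rho>\<^sup>2 * (cos t)\<^sup>2 + K2 * \<rho> ^ 3"
      by linarith
  qed
  hence "pi * \<rho>\<^sup>2 \<le> pi * (\<rho>\<^sup>2 * (2 * K2 * \<rho>))"
    by (simp add: power3_eq_cube power2_eq_square algebra_simps)
  hence "\<rho>\<^sup>2 * 1 \<le> \<rho>\<^sup>2 * (2 * K2 * \<rho>)" using pi_gt_zero by (subst (asm) mult_le_cancel_left_pos) simp_all
  hence "1 \<le> 2 * K2 * \<rho>" using rho by (subst (asm) mult_le_cancel_left_pos) simp_all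
  also have "\<dots> \<le> 2 * K2 * (1 / (4 * (K2 + 1)))" using rho K2 by (intro mult_left_mono) auto
  also have "\<dots> < 1" using K2 by (simp add: divide_less_eq)
  finally show False by simp
qed

text \<open>At an interior maximum of \<open>F\<close> on a thin cylinder around the segment, \<open>\<phi>\<close> would be touched from
  above by a polynomial that is concave along the segment. The penalty \<open>M\<close> keeps the maximum off the
  lateral boundary.\<close>

lemma phi_le_on_segment:
  assumes seg: "closed_segment x y \<subseteq> log_image" and p: "p \<in> closed_segment x y"
  shows "\<phi> p \<le> max (\<phi> x) (\<phi> y) + 2"
proof (rule ccontr)
  define m where "m = max (\<phi> x) (\<phi> y)"
  assume "\<not> \<phi> p \<le> max (\<phi> x) (\<phi> y) + 2"
  hence big: "\<phi> p > m + 2" by (simp add: m_def)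
  define v where "v = y - x"
  have xL: "x \<in> log_image" and yL: "y \<in> log_image" using seg by auto
  have "x \<noteq> y" using p big by (auto simp: m_def)
  hence v: "v \<noteq> 0" by (simp add: v_def)
  \<comment> \<open>\<open>T\<close> is the coordinate along the segment, 0 at \<open>x\<close> and
    1 at \<open>y\<close> when applied to \<open>q - x\<close>; \<open>R\<close> is the orthogonal
    component.\<close>
  define T where "T h = inverse (v \<bullet> v) * (h \<bullet> v)" for h
  define R where "R h = h - T h *\<^sub>R v" for h
  have blT: "bounded_linear T" unfolding T_def
    by (intro bounded_linear_const_mult bounded_linear_inner_left)
  have blR: "bounded_linear R" unfolding R_def
    by (intro bounded_linear_sub bounded_linear_ident bounded_linear_scaleR_const blT)
  note T_lin = bounded_linear.linear[OF blT] and R_lin = bounded_linear.linear[OF blR]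
  have Tv: "T v = 1" using v by (simp add: T_def)
  have Rv: "R v = 0" by (simp add: R_def Tv)
  have dec: "q = x + T (q - x) *\<^sub>R v + R (q - x)" for q by (simp add: R_def)
  obtain e where e: "e > 0" "{q. infdist q (closed_segment x y) \<le> e} \<subseteq> log_image"
    using compact_in_open_separated[OF _ compact_segment open_log_image seg] by auto
  \<comment> \<open>Keeps the maximum of \<open>F\<close> off the two end faces of the cylinder,
    where \<open>\<phi>\<close> is below \<open>m + 1\<close>.\<close>
  have cap: "\<exists>d>0. \<forall>q. dist q w < d \<longrightarrow> \<phi> q < m + 1" if w: "w \<in> log_image" "\<phi> w \<le> m" for w
  proof -
    have "isCont \<phi> w"
      using continuous_on_eq_continuous_at[OF open_log_image] continuous_on_phi w(1) by blast
    then obtain d where "d > 0" "\<forall>q. dist q w < d \<longrightarrow> dist (\<phi> q) (\<phi> w) < 1"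
      unfolding continuous_at_eps_delta by (metis zero_less_one)
    hence "\<forall>q. dist q w < d \<longrightarrow> \<phi> q < m + 1" using w(2) by (fastforce simp: dist_real_def)
    thus ?thesis using \<open>d > 0\<close> by blast
  qed
  obtain dx where dx: "dx > 0" "\<And>q. dist q x < dx \<Longrightarrow> \<phi> q < m + 1"
    using cap[OF xL] by (auto simp: m_def)
  obtain dy where dy: "dy > 0" "\<And>q. dist q y < dy \<Longrightarrow> \<phi> q < m + 1"
    using cap[OF yL] by (auto simp: m_def)
  define \<eta> where "\<eta> = min e (min dx dy) / 2"
  have eta: "\<eta> > 0" "\<eta> < e" "\<eta> < dx" "\<eta> < dy" using e dx dy by (auto simp: \<eta>_def)
  define Z where "Z = {q. 0 \<le> T (q - x) \<and> T (q - x) \<le> 1 \<and> norm (R (q - x)) \<le> \<eta>}"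
  have contT: "continuous_on S (\<lambda>q. T (q - x))" for S
    by (intro linear_continuous_on_compose[OF _ T_lin] continuous_intros)
  have contR: "continuous_on S (\<lambda>q. R (q - x))" for S
    by (intro linear_continuous_on_compose[OF _ R_lin] continuous_intros)
  have "closed Z" unfolding Z_def
    by (intro closed_Collect_conj closed_Collect_le continuous_intros contT contR)
  moreover have "bounded Z"
  proof (rule boundedI)
    fix q assume "q \<in> Z"
    hence q: "\<bar>T (q - x)\<bar> \<le> 1" "norm (R (q - x)) \<le> \<eta>" by (auto simp: Z_def)
    have "norm (T (q - x) *\<^sub>R v) \<le> 1 * norm v"
      unfolding norm_scaleR using q(1) by (intro mult_right_mono) auto
    moreover have "norm q \<le> norm x + norm (T (q - x) *\<^sub>R v) + norm (R (q - x))"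
      by (subst dec[of q]) (intro norm_triangle_mono order_refl)
    ultimately show "norm q \<le> norm x + norm v + \<eta>" using q(2) by linarith
  qed
  ultimately have Z: "compact Z" by (simp add: compact_eq_bounded_closed)
  have segI: "x + t *\<^sub>R v \<in> closed_segment x y" if "0 \<le> t" "t \<le> 1" for t
    using that by (auto simp: closed_segment_def v_def algebra_simps intro!: exI[of _ t])
  have ZL: "Z \<subseteq> log_image"
  proof
    fix q assume q: "q \<in> Z"
    have "infdist q (closed_segment x y) \<le> dist q (x + T (q - x) *\<^sub>R v)"
      using q by (intro infdist_le segI) (auto simp: Z_def)
    also have "\<dots> = norm (R (q - x))" by (simp add: dist_norm R_def algebra_simps)
    also have "\<dots> \<le> e" using q eta by (simp add: Z_def)
    finally show "q \<in> log_image" using e by blast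
  qed
  obtain t0 where t0: "0 \<le> t0" "t0 \<le> 1" "p = x + t0 *\<^sub>R v"
    using p by (auto simp: closed_segment_def v_def algebra_simps)
  have Tp: "T (p - x) = t0" and Rp: "R (p - x) = 0"
    using T_lin R_lin by (simp_all add: t0 linear_scale Tv Rv)
  have pZ: "p \<in> Z" using t0(1,2) eta Tp Rp by (simp add: Z_def)
  have contphi: "continuous_on Z \<phi>" using continuous_on_phi ZL continuous_on_subset by blast
  obtain B where B: "\<And>q. q \<in> Z \<Longrightarrow> \<phi> q \<le> B"
    using continuous_attains_sup[OF Z _ contphi] pZ by blast
  \<comment> \<open>On the lateral boundary this gives \<open>F\<close> \<le> (B + 1) - (B + 2 -
    \<phi> p) = \<phi> p - 1, which is less than \<open>F p\<close>.\<close>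
  define M where "M = (B + 2 - \<phi> p) / \<eta>\<^sup>2"
  have M: "M \<ge> 0" "M * \<eta>\<^sup>2 = B + 2 - \<phi> p" using B[OF pZ] eta by (auto simp: M_def)
  \<comment> \<open>The square of \<open>T\<close> becomes the concave term after passing to
    \<open>\<phi>\<close>. It costs at most 1 on \<open>Z\<close>; with the 1 spent in
    \<open>cap\<close> this is the 2 of the statement.\<close>
  define F where "F q = \<phi> q + (T (q - x))\<^sup>2 - M * (norm (R (q - x)))\<^sup>2" for q
  have "continuous_on Z F" unfolding F_def
    by (intro continuous_on_add continuous_on_diff continuous_on_mult continuous_on_const
        continuous_on_power continuous_on_norm contphi contT contR)
  then obtain q where q: "q \<in> Z" "\<And>r. r \<in> Z \<Longrightarrow> F r \<le> F q"
    using continuous_attains_sup[OF Z] pZ by blast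
  have "F p \<ge> \<phi> p" by (simp add: F_def Rp)
  hence Fq: "F q \<ge> \<phi> p" using q(2)[OF pZ] by simp
  have T01: "0 \<le> T (q - x)" "T (q - x) \<le> 1" and Req: "norm (R (q - x)) \<le> \<eta>"
    using q(1) by (auto simp: Z_def)
  have Tsq: "(T (q - x))\<^sup>2 \<le> 1" using T01 by (simp add: power_le_one)
  have Rsq: "M * (norm (R (q - x)))\<^sup>2 \<ge> 0" using M by simp
  have phiq: "\<phi> q \<ge> m + 1" using Fq Tsq Rsq big unfolding F_def by linarith
  have "norm (R (q - x)) \<noteq> \<eta>"
  proof
    assume "norm (R (q - x)) = \<eta>"
    hence "F q \<le> B + 1 - (B + 2 - \<phi> p)" using B[OF q(1)] Tsq M(2) by (simp add: F_def)
    thus False using Fq by simp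
  qed
  moreover have "T (q - x) \<noteq> 0"
  proof
    assume "T (q - x) = 0"
    hence "dist q x = norm (R (q - x))" by (simp add: R_def dist_norm)
    thus False using dx(2)[of q] eta Req phiq by simp
  qed
  moreover have "T (q - x) \<noteq> 1"
  proof
    assume "T (q - x) = 1"
    hence "dist q y = norm (R (q - x))" by (simp add: R_def dist_norm v_def)
    thus False using dy(2)[of q] eta Req phiq by simp
  qed
  ultimately have "q \<in> {q. 0 < T (q - x)} \<inter> {q. T (q - x) < 1} \<inter> {q. norm (R (q - x)) < \<eta>}"
    using T01 Req by simp
  moreover have "open ({q. 0 < T (q - x)} \<inter> {q. T (q - x) < 1} \<inter> {q. norm (R (q - x)) < \<eta>})"
    by (intro open_Int open_Collect_less continuous_intros contT contR)
  ultimately obtain \<delta> where d: "\<delta> > 0"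
      "ball q \<delta> \<subseteq> {q. 0 < T (q - x)} \<inter> {q. T (q - x) < 1} \<inter> {q. norm (R (q - x)) < \<eta>}"
    by (meson open_contains_ball)
  hence dZ: "ball q \<delta> \<subseteq> Z" by (force simp: Z_def)
  \<comment> \<open>The first-order part in \<open>h\<close> when \<open>F (q + h) \<le> F q\<close>
    is expanded.\<close>
  define l where "l h = 2 * M * (R (q - x) \<bullet> R h) - 2 * T (q - x) * T h" for h
  have bll: "bounded_linear l" unfolding l_def
    by (intro bounded_linear_sub bounded_linear_const_mult blT
        bounded_linear_compose[OF bounded_linear_inner_right blR])
  show False
  proof (rule no_concave_touching[OF d(1) _ bll blT blR Tv Rv M(1)])
    show "ball q \<delta> \<subseteq> log_image" using dZ ZL by blast
  next
    fix h :: "real ^ 'n" assume "norm h < \<delta>"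
    hence "q + h \<in> Z" using dZ by (auto simp: dist_norm)
    hence "F (q + h) \<le> F q" by (rule q(2))
    moreover have "T (q + h - x) = T (q - x) + T h"
      using linear_add[OF T_lin, of "q - x" h] by (simp add: algebra_simps)
    moreover have "R (q + h - x) = R (q - x) + R h"
      using linear_add[OF R_lin, of "q - x" h] by (simp add: algebra_simps)
    moreover have "(norm (R (q - x) + R h))\<^sup>2 =
        (norm (R (q - x)))\<^sup>2 + 2 * (R (q - x) \<bullet> R h) + (norm (R h))\<^sup>2"
      by (simp add: power2_norm_eq_inner inner_add inner_commute)
    ultimately show "\<phi> (q + h) \<le> \<phi> q + l h - (T h)\<^sup>2 + M * (norm (R h))\<^sup>2"
      unfolding F_def l_def by (simp add: power2_sum algebra_simps)
  qed
qed

text \<open>Removing the coordinate hyperplanes does not disconnect \<open>D\<close>. For a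
  splitting into \<open>A\<close> and \<open>B\<close>, the closures of the parts of
  \<open>D\<close> above them cover \<open>D\<close>, hence share a point \<open>p\<close> of
  \<open>D\<close>; but the logarithmic image of a polydisc about \<open>p\<close> is convex and
  would meet both.\<close>

lemma connected_log_image: "connected log_image"
proof -
  have False if AB: "open A" "open B" "A \<noteq> {}" "B \<noteq> {}" "A \<union> B = log_image" "A \<inter> B = {}" for A B
  proof -
    define D' where "D' X = {z \<in> D. (\<forall>j. z $ j \<noteq> 0) \<and> ln_vec z \<in> X}" for X
    have ne: "closure (D' X) \<inter> D \<noteq> {}" if X: "X \<noteq> {}" "X \<subseteq> log_image" for X
    proof -
      obtain a where "a \<in> X" using X by blast
      hence a: "exp_vec a \<in> D" using X by (auto simp: log_image_def)
      moreover have "exp_vec a $ j \<noteq> 0" for j by (simp add: exp_vec_def)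
      ultimately have "exp_vec a \<in> D' X" using \<open>a \<in> X\<close> by (simp add: D'_def)
      thus ?thesis using closure_subset a by blast
    qed
    have cover: "D \<subseteq> closure (D' A) \<union> closure (D' B)"
    proof
      fix z assume z: "z \<in> D"
      have "z \<in> closure (D' A \<union> D' B)" unfolding closure_iff_nhds_not_empty
      proof (intro allI impI)
        fix X V assume V: "V \<subseteq> X" "open V" "z \<in> V"
        hence "open (V \<inter> D)" "z \<in> V \<inter> D" using z open_D by auto
        then obtain r where r: "r > 0" "polydisc z r \<subseteq> V \<inter> D" using open_contains_polydisc by blast
        define w where "w = (\<chi> j. if z $ j = 0 then of_real (r / 2) else z $ j)"
        have "w \<in> polydisc z r" using r by (auto simp: polydisc_def w_def)
        hence w: "w \<in> V" "w \<in> D" using r by auto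
        have w0: "w $ j \<noteq> 0" for j using r by (simp add: w_def)
        hence "ln_vec w \<in> log_image" using ln_vec_mem_log_image_iff w by blast
        hence "w \<in> D' A \<union> D' B" using w w0 AB(5) by (auto simp: D'_def)
        thus "(D' A \<union> D' B) \<inter> X \<noteq> {}" using w V by blast
      qed
      thus "z \<in> closure (D' A) \<union> closure (D' B)" by simp
    qed
    have "closure (D' A) \<inter> closure (D' B) \<inter> D \<noteq> {}"
    proof
      assume "closure (D' A) \<inter> closure (D' B) \<inter> D = {}"
      hence "closure (D' A) \<inter> D = {} \<or> closure (D' B) \<inter> D = {}"
        using connected_closedD[OF connected_D _ cover] by auto
      thus False using ne AB by blast
    qed
    then obtain p where p: "p \<in> D" "p \<in> closure (D' A)" "p \<in> closure (D' B)" by blast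
    obtain r where r: "r > 0" "polydisc p r \<subseteq> D" using open_contains_polydisc[OF open_D p(1)] by blast
    \<comment> \<open>The logarithmic image of the polydisc: a box, possibly unbounded below, which
      makes sense also where \<open>p $ j = 0\<close>.\<close>
    define V where "V = {y :: real ^ 'n. \<forall>j. \<bar>exp (y $ j) - cmod (p $ j)\<bar> < r}"
    have "convex V"
    proof (rule convexI)
      fix a b :: "real ^ 'n" and s t :: real
      assume ab: "a \<in> V" "b \<in> V" and st: "0 \<le> s" "0 \<le> t" "s + t = 1"
      show "s *\<^sub>R a + t *\<^sub>R b \<in> V" unfolding V_def
      proof (intro CollectI allI)
        fix j
        define y where "y = (s *\<^sub>R a + t *\<^sub>R b) $ j"
        have "y \<le> max (a $ j) (b $ j)"
          using convex_bound_le[of "a $ j" "max (a $ j) (b $ j)" "b $ j" s t] st by (simp add: y_def)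
        moreover have "- y \<le> max (- a $ j) (- b $ j)"
          using convex_bound_le[of "- a $ j" "max (- a $ j) (- b $ j)" "- b $ j" s t] st
          by (simp add: y_def)
        ultimately have "exp y \<le> exp (a $ j) \<or> exp y \<le> exp (b $ j)"
          "exp y \<ge> exp (a $ j) \<or> exp y \<ge> exp (b $ j)"
          unfolding exp_le_cancel_iff by linarith+
        moreover have "\<bar>exp (a $ j) - cmod (p $ j)\<bar> < r" "\<bar>exp (b $ j) - cmod (p $ j)\<bar> < r"
          using ab by (auto simp: V_def)
        ultimately show "\<bar>exp ((s *\<^sub>R a + t *\<^sub>R b) $ j) - cmod (p $ j)\<bar> < r"
          unfolding y_def[symmetric] by linarith
      qed
    qed
    hence conV: "connected V" by (rule convex_connected)
    have VL: "V \<subseteq> log_image"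
    proof
      fix y assume y: "y \<in> V"
      \<comment> \<open>The point above \<open>y\<close> with the arguments of \<open>p\<close>, so
        that its coordinates differ from those of \<open>p\<close> only by the difference of
        moduli.\<close>
      define w where "w = (\<chi> j. of_real (exp (y $ j)) * (if p $ j = 0 then 1 else sgn (p $ j)))"
      have "w \<in> polydisc p r" unfolding polydisc_def
      proof (intro CollectI allI)
        fix j
        have "w $ j - p $ j = (of_real (exp (y $ j)) - of_real (cmod (p $ j))) * (if p $ j = 0 then 1 else sgn (p $ j))"
          by (simp add: w_def left_diff_distrib sgn_div_norm scaleR_conv_of_real)
        hence "cmod (w $ j - p $ j) = \<bar>exp (y $ j) - cmod (p $ j)\<bar>"
          by (simp add: norm_mult norm_sgn flip: of_real_diff)
        thus "cmod (w $ j - p $ j) < r" using y by (simp add: V_def)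
      qed
      hence "w \<in> D" using r by blast
      hence "exp_vec y \<in> D"
        by (rule mem_if_same_moduli) (simp add: w_def exp_vec_def norm_mult norm_sgn)
      thus "y \<in> log_image" by (simp add: log_image_def)
    qed
    have meets: "X \<inter> V \<noteq> {}" if pX: "p \<in> closure (D' X)" for X
    proof -
      have "p \<in> polydisc p r" using r by (simp add: polydisc_def)
      then obtain z where z: "z \<in> D' X" "z \<in> polydisc p r"
        using pX open_polydisc unfolding closure_iff_nhds_not_empty by blast
      have "ln_vec z \<in> V" unfolding V_def
      proof (intro CollectI allI)
        fix j
        have "\<bar>cmod (z $ j) - cmod (p $ j)\<bar> \<le> cmod (z $ j - p $ j)" by (rule norm_triangle_ineq3)
        also have "\<dots> < r" using z(2) by (simp add: polydisc_def)
        finally show "\<bar>exp (ln_vec z $ j) - cmod (p $ j)\<bar> < r"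
          using z(1) by (simp add: D'_def ln_vec_def)
      qed
      thus ?thesis using z(1) by (auto simp: D'_def)
    qed
    show False
      using connectedD[OF conV AB(1,2)] AB(5,6) VL meets p by blast
  qed
  thus ?thesis unfolding connected_openin_eq by (metis open_log_image openin_open_eq)
qed

text \<open>The bound on segments is uniform, so the segments from \<open>x\<close> that lie in the image stay away from
  its boundary: the points visible from \<open>x\<close> form a clopen set.\<close>

lemma convex_log_image: "convex log_image"
  unfolding convex_contains_segment
proof (intro ballI)
  fix x y assume x: "x \<in> log_image" and y: "y \<in> log_image"
  define S where "S = {y \<in> log_image. closed_segment x y \<subseteq> log_image}"
  have "open S" unfolding open_contains_ball
  proof
    fix y assume "y \<in> S"
    hence seg: "closed_segment x y \<subseteq> log_image" by (simp add: S_def)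
    obtain e where e: "e > 0" "{q. infdist q (closed_segment x y) \<le> e} \<subseteq> log_image"
      using compact_in_open_separated[OF _ compact_segment open_log_image seg] by auto
    have "y' \<in> S" if y': "y' \<in> ball y e" for y'
    proof -
      have "closed_segment x y' \<subseteq> log_image"
      proof
        fix q assume "q \<in> closed_segment x y'"
        then obtain t where t: "0 \<le> t" "t \<le> 1" "q = (1 - t) *\<^sub>R x + t *\<^sub>R y'"
          by (auto simp: closed_segment_def)
        have "infdist q (closed_segment x y) \<le> dist q ((1 - t) *\<^sub>R x + t *\<^sub>R y)"
          using t by (intro infdist_le) (auto simp: closed_segment_def)
        also have "\<dots> = norm (t *\<^sub>R (y' - y))" by (simp add: t dist_norm scaleR_diff_right)
        also have "\<dots> \<le> 1 * norm (y' - y)" using t unfolding norm_scaleR by (intro mult_right_mono) auto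
        also have "\<dots> \<le> e" using y' by (simp add: dist_norm norm_minus_commute)
        finally show "q \<in> log_image" using e by blast
      qed
      thus ?thesis by (auto simp: S_def)
    qed
    thus "\<exists>e>0. ball y e \<subseteq> S" using e by blast
  qed
  have "y \<in> S" if yS: "y \<in> closure S" and y: "y \<in> log_image" for y
  proof -
    \<comment> \<open>An upper bound for \<open>\<phi>\<close> on segments from \<open>x\<close> to
      points of \<open>S\<close> near \<open>y\<close>. Their points have boundary distance at least
      exp (-C), enough to reach the limit point \<open>exp_vec p\<close>.\<close>
    define C where "C = max (\<phi> x) (\<phi> y + 1) + 2"
    have "closed_segment x y \<subseteq> log_image"
    proof
      fix p assume "p \<in> closed_segment x y"
      then obtain t where t: "0 \<le> t" "t \<le> 1" "p = (1 - t) *\<^sub>R x + t *\<^sub>R y"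
        by (auto simp: closed_segment_def)
      define g where "g y' = (1 - t) *\<^sub>R x + t *\<^sub>R y'" for y'
      have "isCont \<phi> y"
        using continuous_on_eq_continuous_at[OF open_log_image] continuous_on_phi y by blast
      hence 1: "\<forall>\<^sub>F y' in nhds y. \<phi> y' < \<phi> y + 1"
        unfolding continuous_at by (intro order_tendstoD(2)) (auto simp: tendsto_nhds_iff isCont_def)
      have "continuous_on UNIV (\<lambda>y'. exp_vec (g y'))" unfolding g_def
        by (intro continuous_on_compose2[OF continuous_on_exp_vec[of UNIV]] continuous_intros) auto
      hence "isCont (\<lambda>y'. exp_vec (g y')) y" by (simp add: continuous_on_eq_continuous_at)
      hence 2: "\<forall>\<^sub>F y' in nhds y. dist (exp_vec (g y')) (exp_vec p) < exp (- C)"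
        using t(3) unfolding g_def[symmetric]
        by (intro tendstoD) (auto simp: tendsto_nhds_iff isCont_def)
      obtain W where W: "open W" "y \<in> W"
          "\<And>y'. y' \<in> W \<Longrightarrow> \<phi> y' < \<phi> y + 1 \<and> dist (exp_vec (g y')) (exp_vec p) < exp (- C)"
        using eventually_conj[OF 1 2] unfolding eventually_nhds by blast
      obtain y' where y': "y' \<in> S" "y' \<in> W"
        using yS W unfolding closure_iff_nhds_not_empty by blast
      have seg: "closed_segment x y' \<subseteq> log_image" using y' by (simp add: S_def)
      have gs: "g y' \<in> closed_segment x y'" using t by (auto simp: g_def closed_segment_def)
      hence mem: "exp_vec (g y') \<in> D" using seg by (auto simp: log_image_def)
      have "\<phi> (g y') \<le> C"
        using phi_le_on_segment[OF seg gs] conjunct1[OF W(3)[OF y'(2)]] unfolding C_def by linarith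
      hence "- C \<le> ln (bdry_dist D (exp_vec (g y')))" by linarith
      hence "exp (- C) \<le> bdry_dist D (exp_vec (g y'))"
        using ln_ge_iff[OF bdry_dist_pos[OF mem]] by blast
      hence "exp_vec p \<in> D"
        using W(3)[OF y'(2)] by (intro less_bdry_dist_imp_mem[OF mem]) simp
      thus "p \<in> log_image" by (simp add: log_image_def)
    qed
    thus ?thesis using y by (simp add: S_def)
  qed
  moreover have SL: "S \<subseteq> log_image" by (auto simp: S_def)
  ultimately have "S = closure S \<inter> log_image" using closure_subset[of S] by blast
  hence "closedin (top_of_set log_image) S" by (metis closed_closure closedin_closed_Int Int_commute)
  moreover have "x \<in> S" using x by (simp add: S_def)
  moreover have "openin (top_of_set log_image) S"
    using \<open>open S\<close> SL by (intro open_subset)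
  ultimately have "S = log_image" using connected_log_image unfolding connected_clopen by blast
  thus "closed_segment x y \<subseteq> log_image" using y by (auto simp: S_def)
qed

text \<open>In logarithmic coordinates, \<open>z\<close> lies in the interior of the closure of an
  open convex set, which is the set itself.\<close>

lemma interior_closure_mem:
  assumes z: "z \<in> interior (closure D)" and z0: "\<And>j. z $ j \<noteq> 0"
  shows "z \<in> D"
proof -
  \<comment> \<open>A section of \<open>ln_vec\<close> that keeps the arguments of
    \<open>z\<close>.\<close>
  define g where "g y = (\<chi> j. of_real (exp (y $ j - ln_vec z $ j)) * z $ j)" for y
  have gz: "g (ln_vec z) = z" by (simp add: g_def vec_eq_iff)
  have g0: "g y $ j \<noteq> 0" and lg: "ln_vec (g y) = y" for y j
    using z0 by (auto simp: g_def ln_vec_def vec_eq_iff norm_mult ln_mult)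
  have "continuous_on UNIV g" unfolding g_def by (intro continuous_intros)
  hence "open (g -` interior (closure D))" by (intro open_vimage) auto
  moreover have "g -` interior (closure D) \<subseteq> closure log_image"
  proof
    fix y assume "y \<in> g -` interior (closure D)"
    hence cl: "g y \<in> closure D" using interior_subset by auto
    show "y \<in> closure log_image" unfolding closure_iff_nhds_not_empty
    proof (intro allI impI)
      fix X V assume V: "V \<subseteq> X" "open V" "y \<in> V"
      define N where "N = {w :: complex ^ 'n. \<forall>j. w $ j \<noteq> 0}"
      have N: "N = (\<Inter>j. {w. w $ j \<noteq> 0})" by (auto simp: N_def)
      have "open N" unfolding N by (auto intro!: open_INT open_Collect_neq continuous_intros)
      have "continuous_on N ln_vec" unfolding ln_vec_def
        by (intro continuous_on_vec_lambda continuous_on_ln continuous_intros) (auto simp: N_def)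
      hence "open (N \<inter> ln_vec -` V)"
        using \<open>open N\<close> V(2) continuous_open_preimage by blast
      moreover have "g y \<in> N \<inter> ln_vec -` V" using g0 V by (auto simp: N_def lg)
      ultimately obtain w where w: "w \<in> D" "w \<in> N" "ln_vec w \<in> V"
        using cl unfolding closure_iff_nhds_not_empty by blast
      hence "ln_vec w \<in> log_image" using ln_vec_mem_log_image_iff by (auto simp: N_def)
      thus "log_image \<inter> X \<noteq> {}" using w V by blast
    qed
  qed
  ultimately have "ln_vec z \<in> interior (closure log_image)" using z gz by (auto intro!: interiorI)
  hence "ln_vec z \<in> log_image"
    using convex_interior_closure[OF convex_log_image] interior_subset by blast
  thus ?thesis using ln_vec_mem_log_image_iff z0 by blast
qed

section \<open>Upper bound near the boundary\<close>

text \<open>Moving the zero coordinates slightly off 0 gives a point of \<open>D\<close> by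
  \<open>interior_closure_mem\<close>; completeness then allows them to be reset to 0 one at a
  time.\<close>

lemma mem_if_zeros_occur:
  assumes z: "z \<in> interior (closure D)" and zero: "\<And>j. z $ j = 0 \<Longrightarrow> \<exists>p\<in>D. p $ j = 0"
  shows "z \<in> D"
proof -
  obtain r where r: "r > 0" "polydisc z r \<subseteq> interior (closure D)"
    using open_contains_polydisc[OF open_interior z] by blast
  define w where "w = (\<chi> j. if z $ j = 0 then of_real (r / 2) else z $ j)"
  have "w \<in> polydisc z r" using r by (auto simp: polydisc_def w_def)
  hence w: "w \<in> D" using r by (intro interior_closure_mem) (auto simp: w_def)
  have "(\<chi> j. if j \<in> F then z $ j else w $ j) \<in> D" if "F \<subseteq> {j. z $ j = 0}" for F
    using finite[of F] that
  proof (induction F rule: finite_induct)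
    case empty
    thus ?case using w by (simp add: vec_lambda_eta)
  next
    case (insert i F)
    obtain p where p: "p \<in> D" "p $ i = 0" using zero insert.prems by auto
    have "scale_coord i 0 (\<chi> j. if j \<in> F then z $ j else w $ j) \<in> D"
      using insert by (intro scale_coord_mem[OF p]) auto
    moreover have "scale_coord i 0 (\<chi> j. if j \<in> F then z $ j else w $ j) =
        (\<chi> j. if j \<in> insert i F then z $ j else w $ j)"
      using insert.prems by (auto simp: scale_coord_def vec_eq_iff)
    ultimately show ?case by simp
  qed
  from this[of "{j. z $ j = 0}"] show ?thesis by (simp add: w_def vec_lambda_eta cong: if_cong)
qed

text \<open>The projection of \<open>z\<close> to the hyperplane is a frontier point at distance
  |z_j|.\<close>

lemma bdry_dist_le_coord:
  assumes "scale_coord j 0 z \<in> closure D" and "\<And>p. p \<in> D \<Longrightarrow> p $ j \<noteq> 0"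
  shows "bdry_dist D z \<le> cmod (z $ j)"
proof -
  have "scale_coord j 0 z \<notin> D" using assms(2)[of "scale_coord j 0 z"] by (auto simp: scale_coord_def)
  hence "scale_coord j 0 z \<in> frontier D"
    using assms(1) open_D by (simp add: frontier_def interior_open)
  hence "bdry_dist D z \<le> dist z (scale_coord j 0 z)" unfolding bdry_dist_def by (rule infdist_le)
  also have "z - scale_coord j 0 z = axis j (z $ j)"
    by (simp add: scale_coord_def axis_def vec_eq_iff)
  hence "dist z (scale_coord j 0 z) = cmod (z $ j)" by (simp add: dist_norm norm_vec_def L2_set_def axis_def
        if_distrib[of cmod] if_distrib[of "\<lambda>x. x\<^sup>2"] cong: if_cong)
  finally show ?thesis .
qed

text \<open>The disc is \<open>r exp (- ((1 - s\<^sub>j) + s\<^sub>j \<kappa>))\<close> up to rotation, where \<open>\<kappa>\<close> is the Cayley transform onto the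
  right half-plane; the slopes \<open>s\<^sub>j\<close> let all coordinates reach \<open>z\<^sub>j\<close> at the same parameter \<open>\<kappa> = R\<close>.\<close>

lemma lempert_punctured_polydisc:
  assumes r: "0 < r" and J: "J \<noteq> {}"
    and sub: "\<And>w. (\<And>j. j \<in> J \<Longrightarrow> 0 < cmod (w $ j) \<and> cmod (w $ j) < r) \<Longrightarrow>
      (\<And>j. j \<notin> J \<Longrightarrow> w $ j = z $ j) \<Longrightarrow> w \<in> D"
    and z: "\<And>j. j \<in> J \<Longrightarrow> 0 < cmod (z $ j) \<and> cmod (z $ j) < r / exp 2"
    and R: "\<And>j. j \<in> J \<Longrightarrow> ln r - ln (cmod (z $ j)) \<le> R"
  shows "\<exists>w\<in>D. (\<forall>j. if j \<in> J then cmod (w $ j) = r / exp 1 else w $ j = z $ j) \<and>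
    lempert D w z \<le> ereal (1 / 2 * ln R)"
proof -
  define X where "X j = ln r - ln (cmod (z $ j))" for j
  have X: "X j > 2" "X j \<le> R" if "j \<in> J" for j
  proof -
    have "ln (cmod (z $ j)) < ln (r / exp 2)" using z[OF that] r by simp
    thus "X j > 2" using r by (simp add: X_def ln_div)
  qed (use R that in \<open>simp add: X_def\<close>)
  \<comment> \<open>The factor \<open>exp 2\<close> in the bound on \<open>z\<close> makes every
    \<open>X j\<close>, hence \<open>R\<close>, exceed 2; so the slopes \<open>s j\<close> lie in
    (0, 1].\<close>
  have R2: "R > 2" using X J by fastforce
  define s where "s j = (X j - 1) / (R - 1)" for j
  have s: "0 < s j" "s j \<le> 1" "(R - 1) * s j = X j - 1" if "j \<in> J" for j
    using X[OF that] R2 by (auto simp: s_def)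
  \<comment> \<open>With \<kappa> the Cayley transform, \<open>g\<close> is the logarithm of the
    coordinate relative to \<open>z $ j\<close>: at \<kappa> = 1, the centre, it gives modulus
    \<open>r / exp 1\<close>, and it vanishes at \<kappa> = \<open>R\<close>.\<close>
  define g where "g \<xi> j = of_real (X j - 1) - ((1 + \<xi>) / (1 - \<xi>) - 1) * of_real (s j)" for \<xi> :: complex and j
  define f where "f \<xi> = (\<chi> j. if j \<in> J then z $ j * exp (g \<xi> j) else z $ j)" for \<xi>
  have Re: "Re (of_real a - (k - 1) * of_real b) = a - (Re k - 1) * b" for a b :: real and k
    by simp
  have cmf: "cmod (f \<xi> $ j) = r * exp (s j - 1 - s j * Re ((1 + \<xi>) / (1 - \<xi>)))" if j: "j \<in> J" for \<xi> j
  proof -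
    have "cmod (f \<xi> $ j) = exp (ln (cmod (z $ j))) * exp (Re (g \<xi> j))"
      using z[OF j] j by (simp add: f_def norm_mult)
    also have "\<dots> = exp (ln r) * exp (s j - 1 - s j * Re ((1 + \<xi>) / (1 - \<xi>)))"
      unfolding exp_add[symmetric] g_def Re by (simp add: X_def algebra_simps)
    finally show ?thesis using r by simp
  qed
  have fD: "f \<xi> \<in> D" if \<xi>: "cmod \<xi> < 1" for \<xi>
  proof (rule sub)
    fix j assume j: "j \<in> J"
    have "s j - 1 - s j * Re ((1 + \<xi>) / (1 - \<xi>)) < 0"
      using s[OF j] mult_pos_pos[OF s(1)[OF j] Re_cayley_pos[OF \<xi>]] by linarith
    thus "0 < cmod (f \<xi> $ j) \<and> cmod (f \<xi> $ j) < r" using r unfolding cmf[OF j] by simp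
  qed (simp add: f_def)
  have "(\<lambda>\<xi>. f \<xi> $ j) holomorphic_on ball 0 1" for j
    unfolding f_def g_def by (cases "j \<in> J") (auto intro!: holomorphic_intros)
  hence disc: "holomorphic_disc D f" using fD by (auto simp: holomorphic_disc_def)
  \<comment> \<open>The preimage of \<open>R\<close> under the Cayley transform; the distance from 0
    to it is \<open>ln R / 2\<close>.\<close>
  define m where "m = (R - 1) / (R + 1)"
  have m: "0 \<le> m" "m < 1" "(1 + m) / (1 - m) = R" using R2 by (auto simp: m_def field_simps)
  have cm: "(1 + complex_of_real m) / (1 - complex_of_real m) = of_real R"
    using m(3) by (metis of_real_1 of_real_add of_real_diff of_real_divide)
  have "f (of_real m) = z"
  proof -
    have "g (of_real m) j = 0" if "j \<in> J" for j
    proof -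
      have "g (of_real m) j = of_real (X j - 1 - (R - 1) * s j)" unfolding g_def cm by simp
      thus ?thesis using s(3)[OF that] by simp
    qed
    thus ?thesis by (simp add: f_def vec_eq_iff)
  qed
  moreover have "lempert D (f 0) (f (of_real m)) \<le> ereal (poincare_dist 0 (of_real m))"
    using m by (intro lempert_le disc) auto
  moreover have "poincare_dist 0 (of_real m) = 1 / 2 * ln R"
    using m by (simp add: poincare_dist_def artanh_def)
  ultimately have "lempert D (f 0) z \<le> ereal (1 / 2 * ln R)" by simp
  moreover have "\<forall>j. if j \<in> J then cmod (f 0 $ j) = r / exp 1 else f 0 $ j = z $ j"
    using cmf[of _ 0] by (auto simp: exp_minus divide_inverse) (simp add: f_def)
  moreover have "f 0 \<in> D" using fD by simp
  ultimately show ?thesis by blast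
qed

text \<open>\<open>C\<close> bounds the distance from \<open>z0\<close> on the compact
  \<open>K\<close> where the discs of \<open>lempert_punctured_polydisc\<close> start, so it does
  not depend on \<open>z\<close>; only the length of the disc does.\<close>

lemma kobayashi_le_near_boundary:
  assumes z0: "z0 \<in> D" and \<zeta>: "\<zeta> \<in> frontier D" "\<zeta> \<in> interior (closure D)"
  shows "\<exists>(C :: real) U. open U \<and> \<zeta> \<in> U \<and>
    (\<forall>z \<in> D \<inter> U. bdry_dist D z < 1 \<and>
       kobayashi D z0 z \<le> ereal (1 / 2 * ln (- ln (bdry_dist D z)) + C))"
proof -
  \<comment> \<open>In \<open>W\<close> only coordinates that vanish at \<open>\<zeta>\<close> can
    vanish.\<close>
  define W where "W = interior (closure D) \<inter> (\<Inter>j. {z. \<zeta> $ j \<noteq> 0 \<longrightarrow> z $ j \<noteq> 0})"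
  have "open {z :: complex ^ 'n. \<zeta> $ j \<noteq> 0 \<longrightarrow> z $ j \<noteq> 0}" for j
    by (cases "\<zeta> $ j = 0") (auto intro!: open_Collect_neq continuous_intros)
  hence "open W" unfolding W_def by (intro open_Int open_INT) auto
  moreover have "\<zeta> \<in> W" using \<zeta> by (simp add: W_def)
  ultimately obtain r0 where r0: "r0 > 0" "polydisc \<zeta> r0 \<subseteq> W"
    using open_contains_polydisc by blast
  \<comment> \<open>r \<le> 1 makes ln r \<le> 0, so that ln r - ln |z_j| is at most -ln |z_j| and
    thus at most \<open>- ln (bdry_dist D z)\<close>.\<close>
  define r where "r = min r0 1"
  have r: "r > 0" "r \<le> 1" "polydisc \<zeta> r \<subseteq> W" using r0 by (auto simp: r_def polydisc_def)
  define J where "J = {j. \<zeta> $ j = 0 \<and> (\<forall>p\<in>D. p $ j \<noteq> 0)}"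
  have mem: "z \<in> D" if "z \<in> polydisc \<zeta> r" "\<And>j. j \<in> J \<Longrightarrow> z $ j \<noteq> 0" for z
  proof (rule mem_if_zeros_occur)
    have zW: "z \<in> W" using that(1) r(3) by blast
    thus "z \<in> interior (closure D)" by (simp add: W_def)
    fix j assume "z $ j = 0"
    hence "\<zeta> $ j = 0" "j \<notin> J" using zW that(2) by (auto simp: W_def)
    thus "\<exists>p\<in>D. p $ j = 0" by (auto simp: J_def)
  qed
  \<comment> \<open>Otherwise \<open>mem\<close> would place the frontier point
    \<open>\<zeta>\<close> in \<open>D\<close>.\<close>
  have J: "J \<noteq> {}"
    using mem[of \<zeta>] r frontier_disjoint[OF \<zeta>(1)] by (auto simp: polydisc_def)
  have "r / exp 2 < r / exp 1"
    by (rule divide_strict_left_mono) (use r(1) in simp_all)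
  moreover have "r / exp 1 < r" using r(1) by (simp add: divide_less_eq)
  ultimately have er: "r / exp 2 < r / exp 1" "r / exp 1 < r" .
  define K where "K = (\<Inter>j. {w. cmod (w $ j - \<zeta> $ j) \<le> r / exp 1}) \<inter>
    (\<Inter>j\<in>J. {w. r / exp 1 \<le> cmod (w $ j)})"
  have "closed K" unfolding K_def
    by (intro closed_Int closed_INT closed_Collect_le continuous_intros ballI)
  moreover have "bounded K"
  proof (rule boundedI)
    fix w assume w: "w \<in> K"
    have "norm (w - \<zeta>) \<le> (\<Sum>j\<in>UNIV. cmod ((w - \<zeta>) $ j))"
      unfolding norm_vec_def by (rule L2_set_le_sum) auto
    also have "\<dots> \<le> (\<Sum>j\<in>(UNIV::'n set). r / exp 1)"
      using w by (intro sum_mono) (auto simp: K_def)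
    finally show "norm w \<le> norm \<zeta> + (\<Sum>j\<in>(UNIV::'n set). r / exp 1)"
      using norm_triangle_sub[of w \<zeta>] by linarith
  qed
  ultimately have "compact K" by (simp add: compact_eq_bounded_closed)
  moreover have "K \<subseteq> D"
  proof
    fix w assume w: "w \<in> K"
    show "w \<in> D"
    proof (rule mem)
      have "cmod (w $ j - \<zeta> $ j) \<le> r / exp 1" for j
        using w by (simp add: K_def)
      hence "cmod (w $ j - \<zeta> $ j) < r" for j using er(2) by (rule le_less_trans)
      thus "w \<in> polydisc \<zeta> r" by (simp add: polydisc_def)
    next
      fix j assume "j \<in> J"
      hence "r / exp 1 \<le> cmod (w $ j)" using w by (auto simp: K_def)
      thus "w $ j \<noteq> 0" using r by (auto simp: divide_le_0_iff)
    qed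
  qed
  ultimately have "\<exists>C. \<forall>w\<in>K. kobayashi D z0 w \<le> ereal C"
    by (rule kobayashi_bounded_on_compact[OF domain z0])
  then obtain C where C: "\<And>w. w \<in> K \<Longrightarrow> kobayashi D z0 w \<le> ereal C" by blast
  have "bdry_dist D z < 1 \<and> kobayashi D z0 z \<le> ereal (1 / 2 * ln (- ln (bdry_dist D z)) + C)"
    if z: "z \<in> D" "z \<in> polydisc \<zeta> (r / exp 2)" for z
  proof -
    have zr: "cmod (z $ j - \<zeta> $ j) < r / exp 2" for j using z by (simp add: polydisc_def)
    have zr1: "cmod (z $ j - \<zeta> $ j) < r" for j using zr[of j] er by linarith
    have zJ: "0 < cmod (z $ j) \<and> cmod (z $ j) < r / exp 2" if "j \<in> J" for j
      using that zr[of j] z(1) by (auto simp: J_def)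
    have dist: "bdry_dist D z \<le> cmod (z $ j)" if j: "j \<in> J" for j
    proof (rule bdry_dist_le_coord)
      have "scale_coord j 0 z \<in> polydisc \<zeta> r"
        using zr1 j r(1) by (auto simp: polydisc_def scale_coord_def J_def)
      thus "scale_coord j 0 z \<in> closure D"
        using r(3) interior_subset by (auto simp: W_def)
    qed (use j in \<open>auto simp: J_def\<close>)
    define R where "R = - ln (bdry_dist D z)"
    note pos = bdry_dist_pos[OF z(1)]
    have less1: "bdry_dist D z < 1"
    proof -
      obtain j where "j \<in> J" using J by blast
      thus ?thesis using dist[of j] zJ[of j] er r by linarith
    qed
    have "\<exists>w\<in>D. (\<forall>j. if j \<in> J then cmod (w $ j) = r / exp 1 else w $ j = z $ j) \<and>
        lempert D w z \<le> ereal (1 / 2 * ln R)"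
    proof (rule lempert_punctured_polydisc[OF r(1) J _ zJ])
      fix w assume wJ: "\<And>j. j \<in> J \<Longrightarrow> 0 < cmod (w $ j) \<and> cmod (w $ j) < r"
        and w: "\<And>j. j \<notin> J \<Longrightarrow> w $ j = z $ j"
      show "w \<in> D"
      proof (rule mem)
        have "cmod (w $ j - \<zeta> $ j) < r" for j
          using wJ[of j] w[of j] zr1[of j] by (cases "j \<in> J") (auto simp: J_def)
        thus "w \<in> polydisc \<zeta> r" by (simp add: polydisc_def)
      qed (use wJ in force)
    next
      fix j assume j: "j \<in> J"
      have "ln r \<le> 0" using r by simp
      moreover have "ln (bdry_dist D z) \<le> ln (cmod (z $ j))"
        using dist[OF j] pos zJ[OF j] by simp
      ultimately show "ln r - ln (cmod (z $ j)) \<le> R" unfolding R_def by linarith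
    qed
    then obtain w where w: "w \<in> D" "lempert D w z \<le> ereal (1 / 2 * ln R)"
        "\<And>j. if j \<in> J then cmod (w $ j) = r / exp 1 else w $ j = z $ j" by blast
    have "w \<in> K"
    proof -
      have "cmod (w $ j - \<zeta> $ j) \<le> r / exp 1" for j
        using w(3)[of j] zr[of j] er(1) by (cases "j \<in> J") (auto simp: J_def)
      moreover have "r / exp 1 \<le> cmod (w $ j)" if "j \<in> J" for j
        using w(3)[of j] that by simp
      ultimately show ?thesis by (auto simp: K_def)
    qed
    have "kobayashi D z0 z \<le> kobayashi D z0 w + kobayashi D w z" by (rule kobayashi_triangle)
    also have "\<dots> \<le> ereal C + ereal (1 / 2 * ln R)"
      by (intro add_mono C[OF \<open>w \<in> K\<close>] order_trans[OF kobayashi_le_lempert[OF w(1) z(1)] w(2)])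
    finally have "kobayashi D z0 z \<le> ereal (1 / 2 * ln R + C)" by (simp add: add.commute)
    thus ?thesis using less1 by (simp add: R_def)
  qed
  moreover have "\<zeta> \<in> polydisc \<zeta> (r / exp 2)" using r by (simp add: polydisc_def)
  ultimately show ?thesis
    using open_polydisc by (intro exI[of _ C] exI[of _ "polydisc \<zeta> (r / exp 2)"]) auto
qed

end

theorem theorem2:
  fixes D :: "(complex ^ 'n) set" and z0 \<zeta>0 :: "complex ^ 'n"
  assumes "is_domain D" and "reinhardt D" and "pseudoconvex D"
    and "z0 \<in> D" and "\<zeta>0 \<in> frontier D \<inter> interior (closure D)"
  shows "\<exists>(C :: real) U. open U \<and> \<zeta>0 \<in> U \<and>
    (\<forall>z \<in> D \<inter> U. bdry_dist D z < 1 \<and>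
       kobayashi D z0 z \<le> ereal (1 / 2 * ln (- ln (bdry_dist D z)) + C))"
proof -
  interpret pseudoconvex_reinhardt D using assms by unfold_locales auto
  show ?thesis using assms kobayashi_le_near_boundary by blast
qed

end
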